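(* Let $R$ be a commutative domain of characteristic zero containing $\mathbb{Q}$, $d$ a nonzero derivation of $R$, and let $\Gamma$ be a group acting by automorphisms on $B=R(\!(x;d)\!)$ and stabilizing $R$. Assume that there exists in $B^{\Gamma}$ an element of the form $w=gx^{-1}+h$ with $h\in R$ and $g\in U(R)$. Then the derivation $D=g\,d$ restricts to a derivation of $R^{\Gamma}$, and $$A^{\Gamma}=R^{\Gamma}[w;-D],\qquad B_0^{\Gamma}=R^{\Gamma}[[w^{-1};D]],\qquad B^{\Gamma}=R^{\Gamma}(\!(w^{-1};D)\!).$$
   Context: $U(R)$ is the group of invertible elements of $R$. $B=R(\!(x;d)\!)$ is the ring of Laurent series $\sum_{i\ge m}f_ix^i$ ($m\in\mathbb{Z}$, $f_i\in R$) with multiplication determined by $xf=\sum_{n\ge0}d^n(f)x^{n+1}$, equivalently $x^{-1}f=fx^{-1}-d(f)$, for $f\in R$. $B_0=R[[x;d]]$ is the subring of power series $\sum_{i\ge0}f_ix^i$; $A=R[x^{-1};-d]$ is the subring of polynomials in $x^{-1}$ with coefficients in $R$. $\Gamma$ stabilizes $R$ means that each $\gamma\in\Gamma$ restricts to an automorphism of $R$. $R^\Gamma$, $B^\Gamma$ are the subrings of $\Gamma$-invariant elements, and $A^\Gamma=A\cap B^\Gamma$, $B_0^\Gamma=B_0\cap B^\Gamma$. For a ring $S$ with a derivation $D$ (possibly zero): $S[w;-D]$ is the ring of polynomials in $w$ with (left) coefficients in $S$ and $wf=fw-D(f)$; $S[[u;D]]$ (resp. $S(\!(u;D)\!)$)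 is the ring of power series (resp. Laurent series) in $u$ with left coefficients in $S$ and $uf=\sum_{n\ge0}D^n(f)u^{n+1}$, for $f\in S$. *)

theory Defs
  imports
    "HOL-Analysis.Infinite_Sum"
    "HOL-Computational_Algebra.Computational_Algebra"
    "HOL-Algebra.Group_Action"
    "HOL-Algebra.QuotRing"
begin

unbundle fps_syntax

text \<open>The ring \<open>R\<close> is a type of class \<^class>\<open>idom\<close>; a subring \<open>S\<close> of \<open>R\<close> is a set of that type.\<close>

definition derivation_on :: "'a::comm_ring_1 set \<Rightarrow> ('a \<Rightarrow> 'a) \<Rightarrow> bool" where
  "derivation_on S D \<longleftrightarrow>
     (\<forall>a\<in>S. D a \<in> S) \<and>
     (\<forall>a\<in>S. \<forall>b\<in>S. D (a + b) = D a + D b) \<and>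
     (\<forall>a\<in>S. \<forall>b\<in>S. D (a * b) = D a * b + a * D b)"

definition rat_embedding :: "(rat \<Rightarrow> 'a::comm_ring_1) \<Rightarrow> bool" where
  "rat_embedding \<iota> \<longleftrightarrow>
     inj \<iota> \<and> \<iota> 1 = 1 \<and>
     (\<forall>p q. \<iota> (p + q) = \<iota> p + \<iota> q) \<and> (\<forall>p q. \<iota> (p * q) = \<iota> p * \<iota> q)"

text \<open>
  A series with left coefficients \<open>f i\<close> is stored as the \<^typ>\<open>'a fls\<close> with these coefficients;
  the library's (commutative) product of \<^typ>\<open>'a fls\<close> is not used. Iterating
  \<open>u a = (\<Sum>n. D^n(a) u^(n+1))\<close> and its equivalent \<open>u^(-1) a = a u^(-1) - D(a)\<close> gives
  \<open>u^i a = (\<Sum>n. (i (i+1) ... (i+n-1) / n!) D^n(a) u^(i+n))\<close> for every integer \<open>i\<close>; the division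
  is exact. In the product below the ranges of \<open>i\<close> and \<open>n\<close> only cut off terms that vanish.
\<close>

definition skew_times :: "('a::comm_ring_1 \<Rightarrow> 'a) \<Rightarrow> 'a fls \<Rightarrow> 'a fls \<Rightarrow> 'a fls" where
  "skew_times D p q = Abs_fls (\<lambda>k.
     \<Sum>i = fls_subdegree p..k - fls_subdegree q.
       \<Sum>n\<le>nat (k - i - fls_subdegree q).
         p $$ i * of_int (pochhammer i n div fact n) * (D ^^ n) (q $$ (k - i - int n)))"

definition skew_laurent_ring :: "'a::comm_ring_1 set \<Rightarrow> ('a \<Rightarrow> 'a) \<Rightarrow> 'a fls ring" where
  "skew_laurent_ring S D =
     \<lparr>carrier = {f. \<forall>i. f $$ i \<in> S}, mult = skew_times D, one = 1, zero = 0, add = (+)\<rparr>"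

definition power_series_part :: "'a::zero fls set" where
  "power_series_part = {f. \<forall>i<0. f $$ i = 0}"

definition inverse_poly_part :: "'a::zero fls set" where
  "inverse_poly_part = {f. \<forall>i>0. f $$ i = 0}"

definition skew_power_series_ring :: "'a::comm_ring_1 set \<Rightarrow> ('a \<Rightarrow> 'a) \<Rightarrow> 'a fls ring" where
  "skew_power_series_ring S D =
     skew_laurent_ring S D
       \<lparr>carrier := carrier (skew_laurent_ring S D) \<inter> power_series_part\<rparr>"

text \<open>
  Skew polynomials \<open>S[w; \<delta>]\<close> with left coefficients and \<open>w a = a w + \<delta>(a)\<close>. Left multiplication
  by \<open>w\<close> sends \<open>\<Sum>j. b j w^j\<close> to \<open>\<Sum>j. b j w^(j+1) + \<delta>(b j) w^j\<close>.
\<close>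

definition skew_poly_shift :: "('a::comm_ring_1 \<Rightarrow> 'a) \<Rightarrow> 'a poly \<Rightarrow> 'a poly" where
  "skew_poly_shift \<delta> q = pCons 0 q + map_poly \<delta> q"

definition skew_poly_times :: "('a::comm_ring_1 \<Rightarrow> 'a) \<Rightarrow> 'a poly \<Rightarrow> 'a poly \<Rightarrow> 'a poly" where
  "skew_poly_times \<delta> p q =
     (\<Sum>i\<le>degree p. smult (coeff p i) ((skew_poly_shift \<delta> ^^ i) q))"

definition skew_poly_ring :: "'a::comm_ring_1 set \<Rightarrow> ('a \<Rightarrow> 'a) \<Rightarrow> 'a poly ring" where
  "skew_poly_ring S \<delta> =
     \<lparr>carrier = {p. \<forall>i. coeff p i \<in> S}, mult = skew_poly_times \<delta>, one = 1, zero = 0, add = (+)\<rparr>"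

definition acts_by_ring_automorphisms ::
    "('g, 'm) monoid_scheme \<Rightarrow> ('b, 'n) ring_scheme \<Rightarrow> ('g \<Rightarrow> 'b \<Rightarrow> 'b) \<Rightarrow> bool" where
  "acts_by_ring_automorphisms G B \<phi> \<longleftrightarrow>
     group_action G (carrier B) \<phi> \<and> (\<forall>\<gamma>\<in>carrier G. \<phi> \<gamma> \<in> ring_iso B B)"

definition invariant_elements ::
    "('g, 'm) monoid_scheme \<Rightarrow> ('b, 'n) ring_scheme \<Rightarrow> ('g \<Rightarrow> 'b \<Rightarrow> 'b) \<Rightarrow> 'b set" where
  "invariant_elements G B \<phi> = {b \<in> carrier B. \<forall>\<gamma>\<in>carrier G. \<phi> \<gamma> b = b}"

text \<open>The coefficient ring sits in the Laurent series ring as \<^term>\<open>range fls_const\<close>.\<close>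

definition stabilizes_coefficients ::
    "('g, 'm) monoid_scheme \<Rightarrow> ('g \<Rightarrow> 'a::zero fls \<Rightarrow> 'a fls) \<Rightarrow> bool" where
  "stabilizes_coefficients G \<phi> \<longleftrightarrow>
     (\<forall>\<gamma>\<in>carrier G. \<phi> \<gamma> ` range fls_const = range fls_const)"

definition coefficient_invariants ::
    "('g, 'm) monoid_scheme \<Rightarrow> ('g \<Rightarrow> 'a::zero fls \<Rightarrow> 'a fls) \<Rightarrow> 'a set" where
  "coefficient_invariants G \<phi> = {r. \<forall>\<gamma>\<in>carrier G. \<phi> \<gamma> (fls_const r) = fls_const r}"

definition eval_poly_at ::
    "('a::comm_ring_1 fls, 'n) ring_scheme \<Rightarrow> 'a fls \<Rightarrow> 'a poly \<Rightarrow> 'a fls" where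
  "eval_poly_at B w p = (\<Sum>i\<le>degree p. fls_const (coeff p i) \<otimes>\<^bsub>B\<^esub> w [^]\<^bsub>B\<^esub> i)"

definition laurent_term ::
    "('a::comm_ring_1 fls, 'n) ring_scheme \<Rightarrow> 'a fls \<Rightarrow> 'a fls \<Rightarrow> int \<Rightarrow> 'a fls" where
  "laurent_term B u c i = fls_const (c $$ i) \<otimes>\<^bsub>B\<^esub> u [^]\<^bsub>B\<^esub> i"

text \<open>
  The topology on \<^typ>\<open>'a fls\<close> is the library's, whose metric comes from the order in the variable;
  the infinite sum below is therefore the sum of the series in the \<open>x\<close>-adic topology of \<open>B\<close>.
\<close>

definition eval_series_at ::
    "('a::comm_ring_1 fls, 'n) ring_scheme \<Rightarrow> 'a fls \<Rightarrow> 'a fls \<Rightarrow> 'a fls" where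
  "eval_series_at B u c = (\<Sum>\<^sub>\<infinity>i. laurent_term B u c i)"

lemma derivation_on_zero:
  assumes "derivation_on UNIV D"
  shows "D 0 = 0"
proof -
  have "D (0 + 0) = D 0 + D 0"
    using assms unfolding derivation_on_def by blast
  then show ?thesis by simp
qed

lemma derivation_on_funpow_zero:
  assumes "derivation_on UNIV D"
  shows "(D ^^ n) 0 = 0"
  by (induction n) (simp_all add: derivation_on_zero[OF assms])

lemma skew_times_nth:
  "skew_times D p q $$ k =
     (\<Sum>i = fls_subdegree p..k - fls_subdegree q.
       \<Sum>n\<le>nat (k - i - fls_subdegree q).
         p $$ i * of_int (pochhammer i n div fact n) * (D ^^ n) (q $$ (k - i - int n)))"
  unfolding skew_times_def
  by (rule nth_Abs_fls_lower_bound[of "fls_subdegree p + fls_subdegree q"]) auto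

text \<open>The product has left coefficients and satisfies the two defining relations.\<close>

lemma skew_times_const_left: "skew_times D (fls_const a) q = fls_const a * q"
proof (rule fls_eqI)
  fix k
  show "skew_times D (fls_const a) q $$ k = (fls_const a * q) $$ k"
  proof (cases "k < fls_subdegree q")
    case True
    then show ?thesis by (simp add: skew_times_nth)
  next
    case False
    have "(\<Sum>n\<le>m. a * of_int (pochhammer 0 n div fact n) * (D ^^ n) (q $$ (k - int n)))
        = a * q $$ k" for m
      by (subst sum.remove[of _ 0]) (auto intro!: sum.neutral simp: pochhammer_0_left)
    moreover have "(\<Sum>i = 0..k - fls_subdegree q.
          \<Sum>n\<le>nat (k - i - fls_subdegree q).
            fls_const a $$ i * of_int (pochhammer i n div fact n) * (D ^^ n) (q $$ (k - i - int n)))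
        = (\<Sum>n\<le>nat (k - fls_subdegree q).
            a * of_int (pochhammer 0 n div fact n) * (D ^^ n) (q $$ (k - int n)))"
      using False by (subst sum.remove[of _ 0]) (auto intro!: sum.neutral)
    ultimately show ?thesis by (simp add: skew_times_nth)
  qed
qed

lemma skew_times_X_const:
  fixes D :: "'a::comm_ring_1 \<Rightarrow> 'a"
  assumes "derivation_on UNIV D"
  shows "skew_times D fls_X (fls_const a) $$ k = (if k \<ge> 1 then (D ^^ nat (k - 1)) a else 0)"
proof (cases "k \<ge> 1")
  case False
  then show ?thesis by (simp add: skew_times_nth)
next
  case True
  have 1: "(\<Sum>n\<le>nat (k - 1). of_int (pochhammer 1 n div fact n) * (D ^^ n) (if k - 1 = int n then a else 0))
      = (D ^^ nat (k - 1)) a"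
    using True
    by (subst sum.remove[of "{..nat (k - 1)}" "nat (k - 1)"])
      (auto intro!: sum.neutral simp: derivation_on_funpow_zero[OF assms] pochhammer_fact[symmetric]
        split: if_split_asm)
  have "(\<Sum>i = 1..k. \<Sum>n\<le>nat (k - i).
          (fls_X :: 'a fls) $$ i * of_int (pochhammer i n div fact n) * (D ^^ n) (fls_const a $$ (k - i - int n)))
      = (D ^^ nat (k - 1)) a"
    using True by (subst sum.remove[of "{1..k}" 1]) (auto intro!: sum.neutral simp: 1)
  with True show ?thesis by (simp add: skew_times_nth)
qed

lemma skew_times_X_inv_const:
  fixes D :: "'a::comm_ring_1 \<Rightarrow> 'a"
  assumes "derivation_on UNIV D"
  shows "skew_times D fls_X_inv (fls_const a) = fls_const a * fls_X_inv - fls_const (D a)"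
proof (rule fls_eqI)
  fix k
  have p: "pochhammer (- 1) n = (if n = 0 then 1 else if n = 1 then - 1 else (0::int))" for n
  proof (cases "n \<le> 1")
    case True
    then have "n = 0 \<or> n = 1" by auto
    then show ?thesis by auto
  next
    case False
    then obtain m where "n = Suc (Suc m)"
      by (metis One_nat_def le_Suc_eq le_zero_eq not0_implies_Suc)
    then show ?thesis by (simp add: pochhammer_rec)
  qed
  show "skew_times D fls_X_inv (fls_const a) $$ k = (fls_const a * fls_X_inv - fls_const (D a)) $$ k"
  proof (cases "k \<ge> - 1")
    case False
    then show ?thesis by (simp add: skew_times_nth)
  next
    case True
    have 1: "(\<Sum>n\<le>nat (k + 1). of_int (pochhammer (- 1) n div fact n) * (D ^^ n) (if k + 1 = int n then a else 0))
        = of_int (pochhammer (- 1) (nat (k + 1)) div fact (nat (k + 1))) * (D ^^ nat (k + 1)) a"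
      using True
      by (subst sum.remove[of "{..nat (k + 1)}" "nat (k + 1)"])
        (auto intro!: sum.neutral simp: derivation_on_funpow_zero[OF assms] split: if_split_asm)
    have 2: "(\<Sum>i = - 1..k. \<Sum>n\<le>nat (k - i).
            (fls_X_inv :: 'a fls) $$ i * of_int (pochhammer i n div fact n) * (D ^^ n) (fls_const a $$ (k - i - int n)))
        = of_int (pochhammer (- 1) (nat (k + 1)) div fact (nat (k + 1))) * (D ^^ nat (k + 1)) a"
      using True by (subst sum.remove[of "{- 1..k}" "- 1"]) (auto intro!: sum.neutral simp: 1)
    consider "k = - 1" | "k = 0" | "k > 0" using True by linarith
    then have "of_int (pochhammer (- 1) (nat (k + 1)) div fact (nat (k + 1))) * (D ^^ nat (k + 1)) a
        = (fls_const a * fls_X_inv - fls_const (D a)) $$ k"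
      by cases (auto simp: p)
    with 2 show ?thesis by (simp add: skew_times_nth)
  qed
qed

end

theory Submission
  imports Defs
begin

text \<open>
  Put \<open>u = w^(-1)\<close>. Since \<open>g\<close> is a unit, \<open>w = g x^(-1) + h\<close> is invertible, \<open>u\<close> has order one, and
  \<open>w a = a w - D(a)\<close> with \<open>D = g d\<close>. So \<open>u\<close> is as good a variable as \<open>x\<close>: every element of \<open>B\<close> is
  uniquely a series \<open>\<Sum>i. c\<^sub>i u\<^sup>i\<close>, and these series multiply as in \<open>R((u; D))\<close>. An element
  \<open>\<gamma>\<close> of the group fixes \<open>u\<close> and maps \<open>R\<close> to \<open>R\<close>. If \<open>\<gamma>\<close> commutes with infinite sums, it sends
  \<open>\<Sum>i. c\<^sub>i u\<^sup>i\<close> to \<open>\<Sum>i. \<gamma>(c\<^sub>i) u\<^sup>i\<close>, so an element is invariant exactly when all its coefficients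
  with respect to \<open>u\<close> are. This describes the invariants of \<open>B\<close>; those of the power series and of the
  polynomials in \<open>x^(-1)\<close> follow because the change of variable respects both subrings in both
  directions. Finally \<open>D(a) = a w - w a\<close> is invariant together with \<open>a\<close>.

  Continuity of \<open>\<gamma>\<close> is not assumed and comes from algebra (\<open>injective_hom_principal_unit_order\<close>,
  \<open>order_continuous_hom_fixing_w\<close>). A series \<open>1 + f\<close> with \<open>f\<close> of positive order has a square root of
  the same shape, because \<open>2\<close> is invertible in \<open>R\<close>. As \<open>R\<close> is a domain, the order is additive on
  products, so the order of \<open>\<gamma>(1 + f)\<close> is divisible by every power of two and is therefore zero.
  Hence \<open>\<gamma>(f)\<close> has order at least zero; multiplying by powers of the fixed element \<open>u\<close>, one finds
  that \<open>\<gamma>\<close> lowers the order of any series by at most one.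

  Identities between series are reduced to monomials: two additive maps that lower orders by a bounded
  amount agree once they agree on the monomials \<open>a x\<^sup>i\<close> (\<open>order_continuous_eqI\<close>). For multiplicative
  statements the monomials are in turn reduced to the single factor \<open>x^(-1)\<close>, by induction on \<open>i\<close> in
  both directions. Associativity of the skew product (\<open>skew_mult_assoc\<close>) and multiplicativity of
  \<open>c \<mapsto> \<Sum>i. c\<^sub>i u\<^sup>i\<close> (\<open>subst_skew_mult\<close>) are both obtained in this way, from the commutation
  rules \<open>x^(-1) a = a x^(-1) - d(a)\<close> and \<open>w a = a w - D(a)\<close>. Bijectivity of this map needs no solution of
  triangular systems: \<open>x^(-1) = g^(-1) w - g^(-1) h\<close> and \<open>d = g^(-1) D\<close>, so the inverse is a change of
  variable of the same kind.
\<close>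

section \<open>Order-continuous additive maps on Laurent series\<close>

definition order_ge :: "int \<Rightarrow> 'a::zero fls set" where
  "order_ge s = {f. \<forall>k<s. f $$ k = 0}"

definition fls_monom :: "'a::zero \<Rightarrow> int \<Rightarrow> 'a fls" where
  "fls_monom a i = fls_shift (- i) (fls_const a)"

lemma fls_monom_nth [simp]: "fls_monom a i $$ k = (if k = i then a else 0)"
  by (simp add: fls_monom_def)

lemma fls_monom_zero_eq_const: "fls_monom a 0 = fls_const a"
  by (rule fls_eqI) simp

lemma fls_X_inv_eq_monom: "fls_X_inv = fls_monom 1 (- 1)"
  by (rule fls_eqI) simp

lemma order_geI: "(\<And>k. k < s \<Longrightarrow> f $$ k = 0) \<Longrightarrow> f \<in> order_ge s"
  by (simp add: order_ge_def)

lemma order_geD: "f \<in> order_ge s \<Longrightarrow> k < s \<Longrightarrow> f $$ k = 0"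
  by (simp add: order_ge_def)

lemma order_ge_mono: "f \<in> order_ge s \<Longrightarrow> t \<le> s \<Longrightarrow> f \<in> order_ge t"
  by (simp add: order_ge_def)

lemma order_ge_subdegree: "f \<in> order_ge (fls_subdegree f)"
  by (simp add: order_ge_def)

lemma order_ge_zero [simp]: "0 \<in> order_ge s"
  by (simp add: order_ge_def)

lemma order_ge_monom: "s \<le> i \<Longrightarrow> fls_monom a i \<in> order_ge s"
  by (simp add: order_ge_def)

lemma order_ge_add: "f \<in> order_ge s \<Longrightarrow> g \<in> order_ge s \<Longrightarrow> f + g \<in> order_ge s"
  for f g :: "'a::comm_ring_1 fls"
  by (simp add: order_ge_def)

lemma order_ge_diff: "f \<in> order_ge s \<Longrightarrow> g \<in> order_ge s \<Longrightarrow> f - g \<in> order_ge s"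
  for f g :: "'a::comm_ring_1 fls"
  by (simp add: order_ge_def)

lemma order_ge_subdegree_iff: "f \<noteq> 0 \<Longrightarrow> f \<in> order_ge s \<longleftrightarrow> s \<le> fls_subdegree f"
  by (auto intro: fls_subdegree_geI simp: order_ge_def)

lemma fls_eq_zero_if_order_ge_all:
  assumes "\<And>n::nat. f \<in> order_ge (int n)"
  shows "f = 0"
proof (rule fls_eqI)
  fix k
  show "f $$ k = 0 $$ k"
    using order_geD[OF assms[of "nat (k + 1)"], of k] by simp
qed

lemma fls_monom_eq_const_times: "fls_monom a i = fls_const a * fls_monom 1 i"
  for a :: "'a::comm_ring_1"
  by (rule fls_eqI) simp

lemma order_ge_const_times: "f \<in> order_ge s \<Longrightarrow> fls_const a * f \<in> order_ge s"
  for f :: "'a::comm_ring_1 fls"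
  by (simp add: order_ge_def)

text \<open>
  The coefficient of \<open>x^k\<close> is constant from the term with index \<open>k + 1\<close> on, and the limit has these
  eventual coefficients.
\<close>

lemma Cauchy_limit:
  assumes "\<And>n::nat. f (Suc n) - f n \<in> order_ge (int n)"
  obtains y :: "'a::comm_ring_1 fls" where "\<And>n::nat. y - f n \<in> order_ge (int n)"
proof -
  have f: "f (n + m) - f n \<in> order_ge (int n)" for n m
  proof (induction m)
    case (Suc m)
    have "f (Suc (n + m)) - f (n + m) \<in> order_ge (int n)"
      by (rule order_ge_mono[OF assms]) simp
    from order_ge_add[OF this Suc] show ?case by simp
  qed simp
  define y where "y = Abs_fls (\<lambda>k. f (nat (k + 1)) $$ k)"
  have y: "y $$ k = f (nat (k + 1)) $$ k" for k
    unfolding y_def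
  proof (rule nth_Abs_fls_lower_bound[of "min 0 (fls_subdegree (f 0))"])
    show "\<forall>k<min 0 (fls_subdegree (f 0)). f (nat (k + 1)) $$ k = 0"
      by auto
  qed
  have "y - f n \<in> order_ge (int n)" for n
  proof (rule order_geI)
    fix k assume k: "k < int n"
    have "nat (k + 1) + (n - nat (k + 1)) = n" using k by auto
    then have "f n - f (nat (k + 1)) \<in> order_ge (int (nat (k + 1)))"
      using f[of "nat (k + 1)" "n - nat (k + 1)"] by simp
    from order_geD[OF this, of k] show "(y - f n) $$ k = 0"
      by (simp add: y)
  qed
  then show thesis by (rule that)
qed

text \<open>
  A bounded loss of order is allowed because the automorphisms considered below are only shown to
  lower the order by at most one.
\<close>

definition order_continuous :: "('a::comm_ring_1 fls \<Rightarrow> 'a fls) \<Rightarrow> bool" where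
  "order_continuous F \<longleftrightarrow>
     (\<forall>p q. F (p + q) = F p + F q) \<and> (\<exists>e. \<forall>s. \<forall>p\<in>order_ge s. F p \<in> order_ge (s + e))"

lemma order_continuousI:
  assumes "\<And>p q. F (p + q) = F p + F q" and "\<And>s p. p \<in> order_ge s \<Longrightarrow> F p \<in> order_ge (s + e)"
  shows "order_continuous F"
  using assms unfolding order_continuous_def by blast

lemma order_continuous_add: "order_continuous F \<Longrightarrow> F (p + q) = F p + F q"
  by (simp add: order_continuous_def)

lemma additive_zero:
  fixes F :: "'b::ab_group_add \<Rightarrow> 'c::ab_group_add"
  assumes "\<And>p q. F (p + q) = F p + F q"
  shows "F 0 = 0"
  using assms[of 0 0] by simp

lemma additive_diff:
  fixes F :: "'b::ab_group_add \<Rightarrow> 'c::ab_group_add"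
  assumes "\<And>p q. F (p + q) = F p + F q"
  shows "F (p - q) = F p - F q"
  using assms[of "p - q" q] by (simp add: eq_diff_eq)

lemma additive_sum:
  fixes F :: "'b::ab_group_add \<Rightarrow> 'c::ab_group_add"
  assumes "\<And>p q. F (p + q) = F p + F q"
  shows "F (\<Sum>i\<in>A. f i) = (\<Sum>i\<in>A. F (f i))"
  by (induction A rule: infinite_finite_induct) (simp_all add: assms additive_zero[of F, OF assms])

lemma order_continuous_diff: "order_continuous F \<Longrightarrow> F (p - q) = F p - F q"
  by (rule additive_diff) (rule order_continuous_add)

lemma order_continuous_sum: "order_continuous F \<Longrightarrow> F (\<Sum>i\<in>A. f i) = (\<Sum>i\<in>A. F (f i))"
  by (rule additive_sum) (rule order_continuous_add)

lemma order_continuous_compose: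
  assumes "order_continuous F" "order_continuous G"
  shows "order_continuous (\<lambda>p. F (G p))"
proof -
  obtain e e' where e: "\<And>s p. p \<in> order_ge s \<Longrightarrow> F p \<in> order_ge (s + e)"
    and e': "\<And>s p. p \<in> order_ge s \<Longrightarrow> G p \<in> order_ge (s + e')"
    using assms unfolding order_continuous_def by metis
  show ?thesis
    by (rule order_continuousI[of _ "e' + e"])
      (simp_all only: order_continuous_add[OF assms(1)] order_continuous_add[OF assms(2)]
        e e' flip: add.assoc)
qed

lemma order_continuous_id: "order_continuous (\<lambda>p. p)"
  by (rule order_continuousI[of _ 0]) auto

lemma fls_nth_sum: "(\<Sum>i\<in>A. f i) $$ k = (\<Sum>i\<in>A. f i $$ k)"
  for f :: "_ \<Rightarrow> 'a::comm_ring_1 fls"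
  by (induction A rule: infinite_finite_induct) auto

text \<open>
  The coefficient of \<open>x^k\<close> in \<open>F p\<close> depends only on finitely many coefficients of \<open>p\<close>: cutting off
  \<open>p\<close> at a high enough power changes neither \<open>F p\<close> nor \<open>G p\<close> at \<open>x^k\<close> and leaves a finite sum of
  monomials.
\<close>

lemma order_continuous_eqI:
  assumes F: "order_continuous F" and G: "order_continuous G"
    and eq: "\<And>a i. F (fls_monom a i) = G (fls_monom a i)"
  shows "F p = G p"
proof (rule fls_eqI)
  fix k
  obtain e e' where e: "\<And>s p. p \<in> order_ge s \<Longrightarrow> F p \<in> order_ge (s + e)"
    and e': "\<And>s p. p \<in> order_ge s \<Longrightarrow> G p \<in> order_ge (s + e')"
    using F G unfolding order_continuous_def by metis
  \<comment> \<open>What has order at least \<open>M\<close> is sent by \<open>F\<close> and \<open>G\<close> to series without terms up to \<open>x^k\<close>.\<close>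
  define M where "M = max (k + 1 - e) (k + 1 - e')"
  define q where "q = (\<Sum>i\<in>{fls_subdegree p..<M}. fls_monom (p $$ i) i)"
  define r where "r = p - q"
  have q_nth: "q $$ j = (if j \<in> {fls_subdegree p..<M} then p $$ j else 0)" for j
    by (simp add: q_def fls_nth_sum)
  have r: "r \<in> order_ge M"
    by (rule order_geI) (auto simp: r_def q_nth)
  have "F r $$ k = 0" "G r $$ k = 0"
    using order_geD[OF e[OF r], of k] order_geD[OF e'[OF r], of k] by (auto simp: M_def)
  moreover have "F q = G q"
    unfolding q_def order_continuous_sum[OF F] order_continuous_sum[OF G] eq ..
  moreover have "p = q + r" by (simp add: r_def)
  ultimately show "F p $$ k = G p $$ k"
    by (simp add: order_continuous_add[OF F] order_continuous_add[OF G])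
qed

section \<open>The skew Laurent series ring\<close>

text \<open>
  The factor of \<open>d^n(a) x^(i+n)\<close> in \<open>x^i a\<close>, that is, the binomial coefficient \<open>i+n-1\<close> over \<open>n\<close>.
\<close>

definition skew_binomial :: "int \<Rightarrow> nat \<Rightarrow> int" where
  "skew_binomial i n = pochhammer i n div fact n"

lemma skew_binomial_0 [simp]: "skew_binomial i 0 = 1"
  by (simp add: skew_binomial_def)

text \<open>
  This recursion expresses \<open>x^(-1) x^i = x^(i-1)\<close> on the level of the factors above. It is the only
  binomial identity on which associativity rests.
\<close>

lemma skew_binomial_Pascal:
  "skew_binomial (i - 1) (Suc n) = skew_binomial i (Suc n) - skew_binomial i n"
proof -
  have s: "fact n * skew_binomial i n = pochhammer i n" for i n
    unfolding skew_binomial_def by (rule dvd_mult_div_cancel) (rule fact_dvd_pochhammer)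
  have "fact (Suc n) * skew_binomial (i - 1) (Suc n) = (i - 1) * pochhammer i n"
    by (simp only: s pochhammer_rec) simp
  moreover have "fact (Suc n) * (skew_binomial i (Suc n) - skew_binomial i n)
      = (i + int n) * pochhammer i n - int (Suc n) * pochhammer i n"
    using s[of "Suc n" i] s[of n i] by (simp add: pochhammer_rec' algebra_simps)
  ultimately have "fact (Suc n) * skew_binomial (i - 1) (Suc n)
      = fact (Suc n) * (skew_binomial i (Suc n) - skew_binomial i n)"
    by (simp add: algebra_simps)
  then show ?thesis
    by (metis fact_nonzero mult_cancel_left)
qed

lemma skew_binomial_zero_Suc: "skew_binomial 0 (Suc n) = 0"
  by (simp add: skew_binomial_def pochhammer_0_left)

lemma skew_binomial_minus_one: "skew_binomial (- 1) (Suc 0) = - 1" "skew_binomial (- 1) (Suc (Suc n)) = 0"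
  using skew_binomial_Pascal[of 0] by (simp_all add: skew_binomial_zero_Suc)

locale skew_derivation =
  fixes d :: "'a::comm_ring_1 \<Rightarrow> 'a"
  assumes derivation: "derivation_on UNIV d"
begin

abbreviation skew_mult :: "'a fls \<Rightarrow> 'a fls \<Rightarrow> 'a fls" (infixl "\<star>" 70) where
  "p \<star> q \<equiv> skew_times d p q"

lemma d_add: "d (a + b) = d a + d b"
  using derivation by (simp add: derivation_on_def)

lemma d_mult: "d (a * b) = d a * b + a * d b"
  using derivation by (simp add: derivation_on_def)

lemma d_zero [simp]: "d 0 = 0"
  by (rule additive_zero) (rule d_add)

lemma d_one [simp]: "d 1 = 0"
  using d_mult[of 1 1] by simp

lemma d_of_int_mult: "d (of_int m * a) = of_int m * d a"
proof -
  have "d (of_nat k * a) = of_nat k * d a" for k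
    by (induction k) (simp_all add: d_add distrib_right)
  then show ?thesis
    by (cases m rule: int_diff_cases)
      (simp add: left_diff_distrib additive_diff[of d, OF d_add])
qed

lemma funpow_add: "(d ^^ n) (a + b) = (d ^^ n) a + (d ^^ n) b"
  by (induction n) (simp_all add: d_add)

lemma funpow_zero [simp]: "(d ^^ n) 0 = 0"
  by (induction n) simp_all

lemma skew_mult_nth:
  assumes p: "p \<in> order_ge s" and q: "q \<in> order_ge t"
  shows "(p \<star> q) $$ k = (\<Sum>i = s..k - t. \<Sum>n\<le>nat (k - i - t).
    p $$ i * of_int (skew_binomial i n) * (d ^^ n) (q $$ (k - i - int n)))"
proof (cases "p = 0 \<or> q = 0")
  case True
  then show ?thesis by (auto simp: skew_times_nth)
next
  case False
  then have st: "s \<le> fls_subdegree p" "t \<le> fls_subdegree q"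
    using p q order_ge_subdegree_iff by blast+
  let ?f = "\<lambda>i n. p $$ i * of_int (skew_binomial i n) * (d ^^ n) (q $$ (k - i - int n))"
  have inner: "(\<Sum>n\<le>nat (k - i - fls_subdegree q). ?f i n) = (\<Sum>n\<le>nat (k - i - t). ?f i n)" for i
  proof (rule sum.mono_neutral_left)
    have "nat (k - i - fls_subdegree q) \<le> nat (k - i - t)"
      using st by (intro nat_mono) simp
    then show "{..nat (k - i - fls_subdegree q)} \<subseteq> {..nat (k - i - t)}" by simp
    show "\<forall>n\<in>{..nat (k - i - t)} - {..nat (k - i - fls_subdegree q)}. ?f i n = 0"
    proof
      fix n assume "n \<in> {..nat (k - i - t)} - {..nat (k - i - fls_subdegree q)}"
      then have "k - i - int n < fls_subdegree q" by auto
      then show "?f i n = 0" by simp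
    qed
  qed simp
  have "(p \<star> q) $$ k = (\<Sum>i = fls_subdegree p..k - fls_subdegree q. \<Sum>n\<le>nat (k - i - t). ?f i n)"
    by (simp add: skew_times_nth inner flip: skew_binomial_def)
  also have "\<dots> = (\<Sum>i = s..k - t. \<Sum>n\<le>nat (k - i - t). ?f i n)"
  proof (rule sum.mono_neutral_left)
    show "\<forall>i\<in>{s..k - t} - {fls_subdegree p..k - fls_subdegree q}.
        (\<Sum>n\<le>nat (k - i - t). ?f i n) = 0"
      by (auto intro!: sum.neutral)
  qed (use st in auto)
  finally show ?thesis .
qed

lemma order_ge_skew_mult:
  assumes "p \<in> order_ge s" "q \<in> order_ge t"
  shows "p \<star> q \<in> order_ge (s + t)"
  by (rule order_geI) (simp add: skew_mult_nth[OF assms])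

lemma skew_mult_nth_leading:
  assumes "p \<in> order_ge s" "q \<in> order_ge t"
  shows "(p \<star> q) $$ (s + t) = p $$ s * q $$ t"
  by (simp add: skew_mult_nth[OF assms])

lemma common_order: obtains s where "p \<in> order_ge s" "q \<in> order_ge s"
proof
  show "p \<in> order_ge (min (fls_subdegree p) (fls_subdegree q))"
    "q \<in> order_ge (min (fls_subdegree p) (fls_subdegree q))"
    by (auto intro: order_ge_mono[OF order_ge_subdegree])
qed

lemma order_continuous_skew_mult_right: "order_continuous (\<lambda>p. p \<star> q)"
proof (rule order_continuousI[of _ "fls_subdegree q"])
  fix p p' :: "'a fls"
  obtain s where s: "p \<in> order_ge s" "p' \<in> order_ge s" by (rule common_order)
  show "(p + p') \<star> q = p \<star> q + p' \<star> q"
    by (rule fls_eqI)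
      (simp add: s[THEN skew_mult_nth[OF _ order_ge_subdegree]]
        order_ge_add[OF s, THEN skew_mult_nth[OF _ order_ge_subdegree]] distrib_right sum.distrib)
qed (auto intro: order_ge_skew_mult order_ge_subdegree)

lemma order_continuous_skew_mult_left: "order_continuous (\<lambda>q. p \<star> q)"
proof (rule order_continuousI[of _ "fls_subdegree p"])
  fix q q' :: "'a fls"
  obtain s where s: "q \<in> order_ge s" "q' \<in> order_ge s" by (rule common_order)
  show "p \<star> (q + q') = p \<star> q + p \<star> q'"
    by (rule fls_eqI)
      (simp add: s[THEN skew_mult_nth[OF order_ge_subdegree]]
        order_ge_add[OF s, THEN skew_mult_nth[OF order_ge_subdegree]] funpow_add distrib_left
        sum.distrib)
next
  show "p \<star> q \<in> order_ge (s + fls_subdegree p)" if "q \<in> order_ge s" for s q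
    using order_ge_skew_mult[OF order_ge_subdegree that] by (simp add: add.commute)
qed

lemmas skew_mult_add_left = order_continuous_add[OF order_continuous_skew_mult_right]
lemmas skew_mult_add_right = order_continuous_add[OF order_continuous_skew_mult_left]
lemmas skew_mult_diff_left = order_continuous_diff[OF order_continuous_skew_mult_right]
lemmas skew_mult_diff_right = order_continuous_diff[OF order_continuous_skew_mult_left]

lemma skew_mult_zero_left [simp]: "0 \<star> q = 0"
  by (rule fls_eqI) (simp add: skew_times_nth)

lemma skew_mult_zero_right [simp]: "p \<star> 0 = 0"
  by (rule fls_eqI) (simp add: skew_times_nth)

lemma const_times_skew_mult: "(fls_const a * p) \<star> q = fls_const a * (p \<star> q)"
  by (rule fls_eqI)
    (simp add: skew_mult_nth[OF order_ge_const_times[OF order_ge_subdegree[of p]] order_ge_subdegree]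
      skew_mult_nth[OF order_ge_subdegree[of p] order_ge_subdegree] sum_distrib_left mult.assoc)

lemma monom_skew_mult: "fls_monom a i \<star> q = fls_const a * (fls_monom 1 i \<star> q)"
  by (subst fls_monom_eq_const_times) (rule const_times_skew_mult)

lemma X_power_skew_mult_nth:
  assumes q: "q \<in> order_ge t" and N: "k - i - t \<le> int N"
  shows "(fls_monom 1 i \<star> q) $$ k
    = (\<Sum>n\<le>N. of_int (skew_binomial i n) * (d ^^ n) (q $$ (k - i - int n)))"
proof -
  let ?f = "\<lambda>n. of_int (skew_binomial i n) * (d ^^ n) (q $$ (k - i - int n))"
  have "(fls_monom 1 i \<star> q) $$ k = (if i \<le> k - t then \<Sum>n\<le>nat (k - i - t). ?f n else 0)"
  proof (cases "i \<le> k - t")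
    case True
    then show ?thesis
      by (subst skew_mult_nth[OF order_ge_monom[OF order_refl] q], subst sum.remove[of _ i])
        (auto intro!: sum.neutral)
  next
    case False
    then show ?thesis
      by (simp add: skew_mult_nth[OF order_ge_monom[OF order_refl] q])
  qed
  also have "\<dots> = (\<Sum>n\<le>N. ?f n)"
  proof (cases "i \<le> k - t")
    case True
    have "(\<Sum>n\<le>nat (k - i - t). ?f n) = (\<Sum>n\<le>N. ?f n)"
    proof (rule sum.mono_neutral_left)
      show "\<forall>n\<in>{..N} - {..nat (k - i - t)}. ?f n = 0"
      proof
        fix n assume "n \<in> {..N} - {..nat (k - i - t)}"
        then have "k - i - int n < t" by auto
        then show "?f n = 0" by (simp add: order_geD[OF q])
      qed
    qed (use N in auto)
    with True show ?thesis by simp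
  next
    case False
    then show ?thesis
      by (auto intro!: sum.neutral[symmetric] simp: order_geD[OF q])
  qed
  finally show ?thesis .
qed

lemma one_skew_mult [simp]: "1 \<star> q = q"
  using skew_times_const_left[of d 1 q] by simp

lemma skew_mult_one [simp]: "p \<star> 1 = p"
proof -
  have "fls_monom a i \<star> 1 = fls_monom a i" for a i
  proof -
    have "(fls_monom 1 i \<star> 1) $$ k = fls_monom 1 i $$ k" for k
    proof -
      have z: "(d ^^ n) (if b then 1 else 0) = (if n = 0 \<and> b then 1 else 0)" for n b
        by (cases n) (simp_all add: funpow_Suc_right del: funpow.simps)
      have "(1 :: 'a fls) \<in> order_ge 0" by (simp add: order_ge_def)
      from X_power_skew_mult_nth[OF this, of k i "nat (k - i)"] show ?thesis
        by (simp add: z sum.remove[of "{..nat (k - i)}" 0])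
    qed
    then show ?thesis
      by (subst monom_skew_mult) (simp add: fls_eq_iff)
  qed
  then show ?thesis
    by (rule order_continuous_eqI[OF order_continuous_skew_mult_right order_continuous_id])
qed

text \<open>
  Left multiplication by \<open>x^(-1)\<close> has just two terms, since the factors \<open>skew_binomial (- 1) n\<close> vanish
  for \<open>n \<ge> 2\<close>. Inductions over powers of \<open>x\<close> therefore go through \<open>x^(-1)\<close> and not through \<open>x\<close>.
\<close>

lemma X_inv_skew_mult_nth: "(fls_X_inv \<star> q) $$ k = q $$ (k + 1) - d (q $$ k)"
proof -
  obtain N :: nat where N: "k + 1 - fls_subdegree q \<le> int (Suc N)"
    by (rule that[of "nat (k - fls_subdegree q)"]) linarith
  have "(fls_X_inv \<star> q) $$ k = q $$ (k + 1) +
      (\<Sum>n\<le>N. of_int (skew_binomial (- 1) (Suc n)) * (d ^^ Suc n) (q $$ (k - int n)))"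
    using N by (simp add: fls_X_inv_eq_monom X_power_skew_mult_nth[OF order_ge_subdegree, of k "- 1" q "Suc N"]
        sum.atMost_Suc_shift del: sum.atMost_Suc funpow.simps)
  also have "(\<Sum>n\<le>N. of_int (skew_binomial (- 1) (Suc n)) * (d ^^ Suc n) (q $$ (k - int n)))
      = - d (q $$ k)"
  proof (subst sum.remove[of _ 0])
    have "skew_binomial (- 1) (Suc n) = 0" if "n \<noteq> 0" for n
      using that by (cases n) (simp_all add: skew_binomial_minus_one)
    then show "of_int (skew_binomial (- 1) (Suc 0)) * (d ^^ Suc 0) (q $$ (k - int 0)) +
        (\<Sum>n\<in>{..N} - {0}. of_int (skew_binomial (- 1) (Suc n)) * (d ^^ Suc n) (q $$ (k - int n)))
        = - d (q $$ k)"
      by (auto intro!: sum.neutral simp: skew_binomial_minus_one)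
  qed auto
  finally show ?thesis by simp
qed

lemma X_inv_skew_mult_const_times:
  "fls_X_inv \<star> (fls_const b * s) = fls_const b * (fls_X_inv \<star> s) - fls_const (d b) * s"
  by (rule fls_eqI) (simp add: X_inv_skew_mult_nth d_mult algebra_simps)

lemma X_inv_skew_mult_X_power:
  "fls_X_inv \<star> (fls_monom 1 j \<star> q) = fls_monom 1 (j - 1) \<star> q"
proof (rule fls_eqI)
  fix k
  define t where "t = fls_subdegree q"
  have q: "q \<in> order_ge t" by (simp add: t_def order_ge_subdegree)
  define N where "N = nat (k + 1 - j - t)"
  let ?q = "\<lambda>n. q $$ (k - j - int n)"
  have shift: "k + 1 - j - int (Suc n) = k - j - int n" "k - (j - 1) - int (Suc n) = k - j - int n"
    "k + 1 - j - int 0 = k + 1 - j" "k - (j - 1) - int 0 = k + 1 - j" for n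
    by simp_all
  have N: "k + 1 - j - t \<le> int (Suc N)" "k - (j - 1) - t \<le> int (Suc N)"
    by (simp_all add: N_def)
  have a: "(fls_monom 1 j \<star> q) $$ (k + 1) = q $$ (k + 1 - j) +
      (\<Sum>n\<le>N. of_int (skew_binomial j (Suc n)) * (d ^^ Suc n) (?q n))"
    unfolding X_power_skew_mult_nth[OF q N(1)] sum.atMost_Suc_shift shift by simp
  have "d ((fls_monom 1 j \<star> q) $$ k) = d (\<Sum>n\<le>N. of_int (skew_binomial j n) * (d ^^ n) (?q n))"
    by (simp add: X_power_skew_mult_nth[OF q, of k j N] N_def)
  also have "\<dots> = (\<Sum>n\<le>N. of_int (skew_binomial j n) * (d ^^ Suc n) (?q n))"
    by (simp add: additive_sum[of d, OF d_add] d_of_int_mult)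
  finally have b: "d ((fls_monom 1 j \<star> q) $$ k)
      = (\<Sum>n\<le>N. of_int (skew_binomial j n) * (d ^^ Suc n) (?q n))" .
  have c: "(fls_monom 1 (j - 1) \<star> q) $$ k = q $$ (k + 1 - j) +
      (\<Sum>n\<le>N. of_int (skew_binomial (j - 1) (Suc n)) * (d ^^ Suc n) (?q n))"
    unfolding X_power_skew_mult_nth[OF q N(2)] sum.atMost_Suc_shift shift by simp
  show "(fls_X_inv \<star> (fls_monom 1 j \<star> q)) $$ k = (fls_monom 1 (j - 1) \<star> q) $$ k"
    unfolding X_inv_skew_mult_nth a b c
    by (simp add: skew_binomial_Pascal sum_subtractf left_diff_distrib)
qed

text \<open>
  The lowest coefficient survives multiplication by \<open>x^(-1)\<close>. This injectivity is what allows
  ascending inductions over powers of \<open>x\<close> without a formula for left multiplication by \<open>x\<close>.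
\<close>

lemma X_inv_skew_mult_inject:
  assumes "fls_X_inv \<star> p = fls_X_inv \<star> q"
  shows "p = q"
proof (rule ccontr)
  assume "p \<noteq> q"
  then have "p - q \<noteq> 0" by simp
  moreover have "fls_X_inv \<star> (p - q) = 0"
    by (simp add: skew_mult_diff_right assms)
  then have "(p - q) $$ (fls_subdegree (p - q)) = d ((p - q) $$ (fls_subdegree (p - q) - 1))"
    using X_inv_skew_mult_nth[of "p - q" "fls_subdegree (p - q) - 1"]
    by (simp del: fls_minus_nth fls_eq0_below_subdegree)
  moreover have "(p - q) $$ (fls_subdegree (p - q) - 1) = 0"
    by (rule fls_eq0_below_subdegree) simp
  ultimately show False
    using nth_fls_subdegree_nonzero[of "p - q"] by simp
qed

lemma X_inv_skew_mult_monom: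
  "fls_X_inv \<star> fls_monom b j = fls_monom b (j - 1) - fls_monom (d b) j"
  by (rule fls_eqI) (auto simp: X_inv_skew_mult_nth)

text \<open>
  On a monomial \<open>q = b x^j\<close> both sides are computed by moving \<open>x^(-1)\<close> past \<open>b\<close> with the commutation
  rule and then lowering the exponent \<open>j\<close>.
\<close>

lemma X_inv_skew_mult_assoc: "(fls_X_inv \<star> q) \<star> r = fls_X_inv \<star> (q \<star> r)"
proof (rule order_continuous_eqI[of "\<lambda>q. (fls_X_inv \<star> q) \<star> r" "\<lambda>q. fls_X_inv \<star> (q \<star> r)"])
  fix b j
  have "fls_X_inv \<star> (fls_monom b j \<star> r)
      = fls_const b * (fls_X_inv \<star> (fls_monom 1 j \<star> r)) - fls_const (d b) * (fls_monom 1 j \<star> r)"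
    by (subst monom_skew_mult) (rule X_inv_skew_mult_const_times)
  also have "\<dots> = fls_monom b (j - 1) \<star> r - fls_monom (d b) j \<star> r"
    unfolding X_inv_skew_mult_X_power
    by (simp only: monom_skew_mult[of b "j - 1"] monom_skew_mult[of "d b" j])
  also have "\<dots> = (fls_X_inv \<star> fls_monom b j) \<star> r"
    by (simp add: X_inv_skew_mult_monom skew_mult_diff_left)
  finally show "(fls_X_inv \<star> fls_monom b j) \<star> r = fls_X_inv \<star> (fls_monom b j \<star> r)" ..
qed (rule order_continuous_compose[OF order_continuous_skew_mult_right order_continuous_skew_mult_left]
    order_continuous_compose[OF order_continuous_skew_mult_left order_continuous_skew_mult_right])+

lemma X_power_skew_mult_assoc: "(fls_monom 1 i \<star> q) \<star> r = fls_monom 1 i \<star> (q \<star> r)"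
proof (induction i rule: int_induct[of _ 0])
  case base
  then show ?case by (simp add: fls_monom_zero_eq_const)
next
  case (step1 i)
  have "fls_X_inv \<star> ((fls_monom 1 (i + 1) \<star> q) \<star> r) = (fls_X_inv \<star> (fls_monom 1 (i + 1) \<star> q)) \<star> r"
    by (rule X_inv_skew_mult_assoc[symmetric])
  also have "\<dots> = fls_X_inv \<star> (fls_monom 1 (i + 1) \<star> (q \<star> r))"
    by (simp add: X_inv_skew_mult_X_power step1)
  finally have "fls_X_inv \<star> ((fls_monom 1 (i + 1) \<star> q) \<star> r)
      = fls_X_inv \<star> (fls_monom 1 (i + 1) \<star> (q \<star> r))" .
  then show ?case by (rule X_inv_skew_mult_inject)
next
  case (step2 i)
  then show ?case
    by (simp add: X_inv_skew_mult_assoc flip: X_inv_skew_mult_X_power)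
qed

lemma skew_mult_assoc: "(p \<star> q) \<star> r = p \<star> (q \<star> r)"
proof (rule order_continuous_eqI[of "\<lambda>p. (p \<star> q) \<star> r" "\<lambda>p. p \<star> (q \<star> r)"])
  show "order_continuous (\<lambda>p. p \<star> q \<star> r)"
    by (rule order_continuous_compose[OF order_continuous_skew_mult_right order_continuous_skew_mult_right])
  show "order_continuous (\<lambda>p. p \<star> (q \<star> r))"
    by (rule order_continuous_skew_mult_right)
  show "(fls_monom a i \<star> q) \<star> r = fls_monom a i \<star> (q \<star> r)" for a i
    unfolding monom_skew_mult[of a i] const_times_skew_mult X_power_skew_mult_assoc ..
qed

abbreviation skew_ring :: "'a fls ring" where
  "skew_ring \<equiv> skew_laurent_ring UNIV d"

lemma skew_ring_simps [simp]:
  "carrier skew_ring = UNIV" "mult skew_ring = skew_times d" "one skew_ring = 1"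
  "zero skew_ring = 0" "add skew_ring = (+)"
  by (simp_all add: skew_laurent_ring_def)

lemma ring_skew_ring: "ring skew_ring"
proof (rule ringI)
  show "abelian_group skew_ring"
  proof (rule abelian_groupI)
    show "\<exists>y\<in>carrier skew_ring. y \<oplus>\<^bsub>skew_ring\<^esub> x = \<zero>\<^bsub>skew_ring\<^esub>" for x
      by (rule bexI[of _ "- x"]) simp_all
  qed (simp_all add: ac_simps)
  show "monoid skew_ring"
    by (rule monoidI) (auto simp: skew_mult_assoc)
qed (auto simp: skew_mult_add_left skew_mult_add_right)

sublocale B: ring "skew_laurent_ring UNIV d"
  by (rule ring_skew_ring)

end

section \<open>Order and units\<close>

locale skew_domain = skew_derivation d for d :: "'a::idom \<Rightarrow> 'a"
begin

lemma fls_subdegree_skew_mult: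
  assumes "p \<noteq> 0" "q \<noteq> 0"
  shows "p \<star> q \<noteq> 0" and "fls_subdegree (p \<star> q) = fls_subdegree p + fls_subdegree q"
proof -
  have "(p \<star> q) $$ (fls_subdegree p + fls_subdegree q) \<noteq> 0"
    using assms by (simp add: skew_mult_nth_leading[OF order_ge_subdegree order_ge_subdegree])
  then show "p \<star> q \<noteq> 0" and "fls_subdegree (p \<star> q) = fls_subdegree p + fls_subdegree q"
    using order_geD[OF order_ge_skew_mult[OF order_ge_subdegree[of p] order_ge_subdegree[of q]]]
    by (auto intro: fls_subdegree_eqI)
qed

lemma skew_mult_left_cancel: "p \<noteq> 0 \<Longrightarrow> p \<star> q = p \<star> r \<Longrightarrow> q = r"
  using fls_subdegree_skew_mult(1)[of p "q - r"] by (auto simp: skew_mult_diff_right)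

text \<open>
  Newton-like iteration \<open>y \<mapsto> y + (p - y^2)/2\<close>, starting at 1. With \<open>y = 1 + z\<close> and \<open>e = (p - y^2)/2\<close>
  the new error is \<open>- (e z + z e + e^2)\<close>, which has higher order than \<open>e\<close> because \<open>z\<close> and \<open>e\<close> have
  positive order. No two of these elements need commute.
\<close>

lemma principal_unit_has_square_root:
  fixes p :: "'a fls" and half :: 'a
  assumes half: "2 * half = 1" and p: "p - 1 \<in> order_ge 1"
  obtains y where "y - 1 \<in> order_ge 1" "y \<star> y = p"
proof -
  define f where "f = rec_nat (1 :: 'a fls) (\<lambda>_ y. y + fls_const half * (p - y \<star> y))"
  have f_0: "f 0 = 1" and f_Suc: "f (Suc n) = f n + fls_const half * (p - f n \<star> f n)" for n
    by (simp_all add: f_def)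
  have f: "f n - 1 \<in> order_ge 1 \<and> p - f n \<star> f n \<in> order_ge (int n + 1)" for n
  proof (induction n)
    case 0
    then show ?case using p by (simp add: f_0)
  next
    case (Suc n)
    define z where "z = f n - 1"
    define e where "e = fls_const half * (p - f n \<star> f n)"
    have z: "z \<in> order_ge 1" and e: "e \<in> order_ge (int n + 1)"
      using Suc by (simp_all add: z_def e_def order_ge_const_times)
    have "e + e = p - f n \<star> f n"
      unfolding e_def by (intro fls_eqI) (simp add: half)
    moreover have "f n = 1 + z" by (simp add: z_def)
    moreover have "f (Suc n) = 1 + z + e" by (simp add: f_Suc z_def e_def)
    ultimately have "p - f (Suc n) \<star> f (Suc n) = - (e \<star> z + z \<star> e + e \<star> e)"
      by (simp add: skew_mult_add_left skew_mult_add_right algebra_simps)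
    moreover have "e \<star> z \<in> order_ge (int (Suc n) + 1)"
      by (rule order_ge_mono[OF order_ge_skew_mult[OF e z]]) simp
    moreover have "z \<star> e \<in> order_ge (int (Suc n) + 1)"
      by (rule order_ge_mono[OF order_ge_skew_mult[OF z e]]) simp
    moreover have "e \<star> e \<in> order_ge (int (Suc n) + 1)"
      by (rule order_ge_mono[OF order_ge_skew_mult[OF e e]]) simp
    ultimately have "p - f (Suc n) \<star> f (Suc n) \<in> order_ge (int (Suc n) + 1)"
      by (simp add: order_ge_def)
    moreover have "f (Suc n) - 1 = z + e" by (simp add: f_Suc z_def e_def)
    then have "f (Suc n) - 1 \<in> order_ge 1"
      using order_ge_add[OF z order_ge_mono[OF e, of 1]] by simp
    ultimately show ?case by simp
  qed
  have "f (Suc n) - f n \<in> order_ge (int n)" for n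
    by (rule order_ge_mono[of _ "int n + 1"]) (simp_all add: f_Suc f order_ge_const_times)
  from Cauchy_limit[of f, OF this] obtain y where y: "\<And>n. y - f n \<in> order_ge (int n)"
    by metis
  have y1: "y - 1 \<in> order_ge 1"
    using order_ge_add[OF y[of 1, simplified] conjunct1[OF f, of 1]] by simp
  then have y0: "y \<in> order_ge 0"
    using order_ge_add[OF order_ge_mono[OF y1, of 0] order_ge_monom[of 0 0 1]]
    by (simp add: fls_monom_zero_eq_const)
  have "y \<star> y - p = 0"
  proof (rule fls_eq_zero_if_order_ge_all)
    fix n :: nat
    have fn: "f n \<in> order_ge 0"
      using order_ge_add[OF order_ge_mono[OF conjunct1[OF f], of 0] order_ge_monom[of 0 0 1]]
      by (simp add: fls_monom_zero_eq_const)
    have "(y - f n) \<star> y \<in> order_ge (int n)" "f n \<star> (y - f n) \<in> order_ge (int n)"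
      using order_ge_skew_mult[OF y y0] order_ge_skew_mult[OF fn y] by simp_all
    moreover have "p - f n \<star> f n \<in> order_ge (int n)"
      by (rule order_ge_mono[OF conjunct2[OF f]]) simp
    moreover have "y \<star> y - p = (y - f n) \<star> y + f n \<star> (y - f n) - (p - f n \<star> f n)"
      by (simp add: skew_mult_diff_left skew_mult_diff_right)
    ultimately show "y \<star> y - p \<in> order_ge (int n)"
      by (simp add: order_ge_def)
  qed
  with y1 show thesis by (intro that) simp_all
qed

text \<open>
  Square roots of principal units are principal units again, so square roots can be extracted over and
  over. Each extraction halves the order of the image; only order zero can be halved without end.
\<close>

lemma injective_hom_principal_unit_order:
  fixes F :: "'a fls \<Rightarrow> 'a fls" and half :: 'a
  assumes half: "2 * half = 1"
    and F_mult: "\<And>p q. F (p \<star> q) = F p \<star> F q" and F_nonzero: "\<And>p. p \<noteq> 0 \<Longrightarrow> F p \<noteq> 0"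
    and p: "p - 1 \<in> order_ge 1"
  shows "fls_subdegree (F p) = 0"
proof -
  have nz: "F q \<noteq> 0" if "q - 1 \<in> order_ge 1" for q
    using order_geD[OF that, of 0] by (intro F_nonzero) auto
  have dvd: "2 ^ n dvd fls_subdegree (F q)" if "q - 1 \<in> order_ge 1" for n q
    using that
  proof (induction n arbitrary: q)
    case (Suc n)
    obtain y where y: "y - 1 \<in> order_ge 1" "y \<star> y = q"
      by (rule principal_unit_has_square_root[OF half Suc.prems])
    have "fls_subdegree (F q) = 2 * fls_subdegree (F y)"
      using fls_subdegree_skew_mult(2)[OF nz nz, OF y(1) y(1)] by (simp flip: F_mult add: y(2))
    with Suc.IH[OF y(1)] show ?case by simp
  qed simp
  show ?thesis
  proof (rule ccontr)
    assume "fls_subdegree (F p) \<noteq> 0"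
    then have "2 ^ n \<le> \<bar>fls_subdegree (F p)\<bar>" for n
      using dvd_imp_le_int[OF _ dvd[OF p]] by simp
    from this[of "nat \<bar>fls_subdegree (F p)\<bar>"] show False
      using of_nat_less_two_power[of "nat \<bar>fls_subdegree (F p)\<bar>", where 'a = int] by simp
  qed
qed

end

section \<open>Series in a family of increasing order\<close>

definition coefficient_series :: "(int \<Rightarrow> 'a fls) \<Rightarrow> 'a::comm_ring_1 fls \<Rightarrow> 'a fls" where
  "coefficient_series W c = Abs_fls (\<lambda>k. \<Sum>i = fls_subdegree c..k. c $$ i * W i $$ k)"

lemma coefficient_series_nth:
  assumes c: "c \<in> order_ge s"
  shows "coefficient_series W c $$ k = (\<Sum>i = s..k. c $$ i * W i $$ k)"
proof (cases "c = 0")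
  case True
  then show ?thesis
    unfolding coefficient_series_def by (subst nth_Abs_fls_lower_bound[of 0]) auto
next
  case False
  then have s: "s \<le> fls_subdegree c" using c order_ge_subdegree_iff by blast
  have "coefficient_series W c $$ k = (\<Sum>i = fls_subdegree c..k. c $$ i * W i $$ k)"
    unfolding coefficient_series_def by (subst nth_Abs_fls_lower_bound[of "fls_subdegree c"]) auto
  also have "\<dots> = (\<Sum>i = s..k. c $$ i * W i $$ k)"
    by (rule sum.mono_neutral_left) (use s in auto)
  finally show ?thesis .
qed

lemma order_ge_coefficient_series:
  assumes "c \<in> order_ge s"
  shows "coefficient_series W c \<in> order_ge s"
  by (rule order_geI) (simp add: coefficient_series_nth[OF assms])

lemma order_continuous_coefficient_series: "order_continuous (coefficient_series W)"
proof (rule order_continuousI[of _ 0])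
  fix c c' :: "'a fls"
  have c: "c \<in> order_ge (min (fls_subdegree c) (fls_subdegree c'))"
    "c' \<in> order_ge (min (fls_subdegree c) (fls_subdegree c'))"
    by (auto intro: order_ge_mono[OF order_ge_subdegree])
  show "coefficient_series W (c + c') = coefficient_series W c + coefficient_series W c'"
    by (rule fls_eqI)
      (simp add: c[THEN coefficient_series_nth] order_ge_add[OF c, THEN coefficient_series_nth]
        distrib_right sum.distrib)
qed (simp add: order_ge_coefficient_series)

lemma coefficient_series_const_times:
  "coefficient_series W (fls_const a * c) = fls_const a * coefficient_series W c"
  by (rule fls_eqI)
    (simp add: coefficient_series_nth[OF order_ge_subdegree[of c]]
      coefficient_series_nth[OF order_ge_const_times[OF order_ge_subdegree[of c]]]
      sum_distrib_left mult.assoc)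

lemma coefficient_series_monom:
  assumes "W i \<in> order_ge i"
  shows "coefficient_series W (fls_monom a i) = fls_const a * W i"
proof (rule fls_eqI)
  fix k
  have "(\<Sum>j = i..k. fls_monom a i $$ j * W j $$ k) = (if i \<le> k then a * W i $$ k else 0)"
    by (auto simp: sum.remove[of _ i] intro!: sum.neutral)
  then show "coefficient_series W (fls_monom a i) $$ k = (fls_const a * W i) $$ k"
    using order_geD[OF assms, of k] by (simp add: coefficient_series_nth[OF order_ge_monom[OF order_refl]])
qed

lemma dist_fls_le:
  assumes "p - q \<in> order_ge (int n)"
  shows "dist p q \<le> inverse (2 ^ n)"
proof (cases "p = q")
  case False
  then have "int n \<le> fls_subdegree (p - q)"
    using assms order_ge_subdegree_iff[of "p - q"] by simp
  with False show ?thesis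
    by (auto simp: dist_fls_def nat_le_iff intro!: le_imp_inverse_le power_increasing)
qed simp

text \<open>
  Only the terms with \<open>i \<le> k\<close> contribute to the coefficient of \<open>x^k\<close>, so a finite partial sum that
  contains all indices from the order of \<open>c\<close> up to \<open>n\<close> agrees with the limit below \<open>x^n\<close>.
\<close>

lemma has_sum_coefficient_series:
  fixes c :: "'a::comm_ring_1 fls"
  assumes W: "\<And>i. W i \<in> order_ge i"
  shows "((\<lambda>i. fls_const (c $$ i) * W i) has_sum coefficient_series W c) UNIV"
  unfolding has_sum_def tendsto_iff
proof (intro allI impI)
  fix e :: real assume "e > 0"
  then obtain n :: nat where n: "inverse (2 ^ n) < e"
    using real_arch_pow_inv[of e "1 / 2"] by (auto simp: power_one_over inverse_eq_divide)
  have "dist (\<Sum>i\<in>Y. fls_const (c $$ i) * W i) (coefficient_series W c) < e"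
    if Y: "finite Y" "{fls_subdegree c..int n} \<subseteq> Y" for Y
  proof (rule le_less_trans[OF dist_fls_le n], rule order_geI)
    fix k assume k: "k < int n"
    have "(\<Sum>i\<in>Y. c $$ i * W i $$ k) = (\<Sum>i = fls_subdegree c..k. c $$ i * W i $$ k)"
    proof (rule sum.mono_neutral_right)
      show "\<forall>i\<in>Y - {fls_subdegree c..k}. c $$ i * W i $$ k = 0"
        using order_geD[OF W] by (auto simp: not_le)
    qed (use Y k in auto)
    then show "((\<Sum>i\<in>Y. fls_const (c $$ i) * W i) - coefficient_series W c) $$ k = 0"
      by (simp add: fls_nth_sum coefficient_series_nth[OF order_ge_subdegree])
  qed
  then show "\<forall>\<^sub>F Y in finite_subsets_at_top UNIV.
      dist (\<Sum>i\<in>Y. fls_const (c $$ i) * W i) (coefficient_series W c) < e"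
    unfolding eventually_finite_subsets_at_top
    by (intro exI[of _ "{fls_subdegree c..int n}"]) auto
qed

section \<open>Skew polynomials as polynomials in the inverse variable\<close>

definition inverse_poly :: "'a::zero poly \<Rightarrow> 'a fls" where
  "inverse_poly p = Abs_fls (\<lambda>k. if k \<le> 0 then coeff p (nat (- k)) else 0)"

lemma inverse_poly_nth: "inverse_poly p $$ k = (if k \<le> 0 then coeff p (nat (- k)) else 0)"
  unfolding inverse_poly_def
  by (rule nth_Abs_fls_lower_bound[of "- int (degree p)"]) (auto simp: coeff_eq_0)

lemma inverse_poly_add: "inverse_poly (p + q) = inverse_poly p + inverse_poly q"
  for p q :: "'a::comm_ring_1 poly"
  by (rule fls_eqI) (simp add: inverse_poly_nth)

lemma inverse_poly_smult: "inverse_poly (smult a p) = fls_const a * inverse_poly p"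
  for p :: "'a::comm_ring_1 poly"
  by (rule fls_eqI) (simp add: inverse_poly_nth)

lemma inverse_poly_one: "inverse_poly (1 :: 'a::comm_ring_1 poly) = 1"
  by (rule fls_eqI) (auto simp: inverse_poly_nth coeff_1)

lemma inverse_poly_conv_sum:
  "inverse_poly p = (\<Sum>i\<le>degree p. fls_monom (coeff p i) (- int i))"
  for p :: "'a::comm_ring_1 poly"
proof (rule fls_eqI)
  fix k
  have "(\<Sum>i\<le>degree p. if k = - int i then coeff p i else 0) = (if k \<le> 0 then coeff p (nat (- k)) else 0)"
  proof (cases "k \<le> 0")
    case True
    then have "k = - int i \<longleftrightarrow> i = nat (- k)" for i by auto
    with True show ?thesis by (simp add: coeff_eq_0)
  next
    case False
    then show ?thesis by (auto intro!: sum.neutral)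
  qed
  then show "inverse_poly p $$ k = (\<Sum>i\<le>degree p. fls_monom (coeff p i) (- int i)) $$ k"
    by (simp add: inverse_poly_nth fls_nth_sum)
qed

lemma inj_inverse_poly: "inj inverse_poly"
proof (rule injI, rule poly_eqI)
  fix p q :: "'a poly" and n
  assume "inverse_poly p = inverse_poly q"
  then have "inverse_poly p $$ (- int n) = inverse_poly q $$ (- int n)" by simp
  then show "coeff p n = coeff q n" by (simp add: inverse_poly_nth)
qed

lemma range_inverse_poly: "range inverse_poly = (inverse_poly_part :: 'a::comm_ring_1 fls set)"
proof (intro equalityI subsetI)
  fix f :: "'a fls" assume f: "f \<in> inverse_poly_part"
  define p where "p = (\<Sum>i\<le>nat (- fls_subdegree f). monom (f $$ (- int i)) i)"
  have "coeff p n = f $$ (- int n)" for n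
    by (auto simp: p_def coeff_sum not_le)
  then have "inverse_poly p = f"
    using f by (intro fls_eqI) (simp add: inverse_poly_nth inverse_poly_part_def)
  then show "f \<in> range inverse_poly" by blast
qed (auto simp: inverse_poly_part_def inverse_poly_nth)

context skew_derivation
begin

lemma inverse_poly_skew_poly_shift:
  "inverse_poly (skew_poly_shift (\<lambda>r. - d r) q) = fls_X_inv \<star> inverse_poly q"
proof (rule fls_eqI)
  fix k
  have "nat (- k) = Suc (nat (- (k + 1)))" if "k < 0"
    using that by simp
  then show "inverse_poly (skew_poly_shift (\<lambda>r. - d r) q) $$ k = (fls_X_inv \<star> inverse_poly q) $$ k"
    by (cases k "0 :: int" rule: linorder_cases)
      (simp_all add: inverse_poly_nth skew_poly_shift_def X_inv_skew_mult_nth coeff_map_poly)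
qed

text \<open>
  Both products are built from the left multiplication by the variable, and the two left
  multiplications correspond when the variable is sent to \<open>x^(-1)\<close>; the sign of the derivation comes from
  \<open>x^(-1) a = a x^(-1) - d(a)\<close>.
\<close>

lemma inverse_poly_skew_poly_times:
  "inverse_poly (skew_poly_times (\<lambda>r. - d r) p q) = inverse_poly p \<star> inverse_poly q"
proof -
  have pow: "inverse_poly ((skew_poly_shift (\<lambda>r. - d r) ^^ i) q) = fls_monom 1 (- int i) \<star> inverse_poly q" for i
  proof (induction i)
    case 0
    then show ?case by (simp add: fls_monom_zero_eq_const)
  next
    case (Suc i)
    have "- int (Suc i) = - int i - 1" by simp
    with Suc show ?case
      by (simp only: funpow.simps comp_apply inverse_poly_skew_poly_shift X_inv_skew_mult_X_power)
  qed
  have "inverse_poly (skew_poly_times (\<lambda>r. - d r) p q)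
      = (\<Sum>i\<le>degree p. fls_const (coeff p i) * (fls_monom 1 (- int i) \<star> inverse_poly q))"
    unfolding skew_poly_times_def additive_sum[of inverse_poly, OF inverse_poly_add]
    by (simp add: inverse_poly_smult pow)
  also have "\<dots> = (\<Sum>i\<le>degree p. fls_monom (coeff p i) (- int i) \<star> inverse_poly q)"
    by (intro sum.cong refl) (rule monom_skew_mult[symmetric])
  also have "\<dots> = inverse_poly p \<star> inverse_poly q"
    unfolding inverse_poly_conv_sum[of p] order_continuous_sum[OF order_continuous_skew_mult_right] ..
  finally show ?thesis .
qed

end

section \<open>Change of variable\<close>

text \<open>
  With an equivalence in the step, one argument serves for increasing and for decreasing exponents: both
  sides of an identity at \<open>i - 1\<close> are \<open>w\<close> (or \<open>x^(-1)\<close>) times the sides at \<open>i\<close>, and this factor can be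
  cancelled.
\<close>

lemma int_predecessor_induct [case_names zero step]:
  assumes "P 0" and "\<And>i. P i \<longleftrightarrow> P (i - 1)"
  shows "P (i :: int)"
proof (induction i rule: int_induct[of _ 0])
  case (step1 i)
  with assms(2)[of "i + 1"] show ?case by simp
qed (use assms in \<open>blast+\<close>)

locale coordinate_change = skew_domain d for d :: "'a::idom \<Rightarrow> 'a" +
  fixes g h g' :: 'a
  assumes g_inverse: "g * g' = 1"
begin

definition w :: "'a fls" where
  "w = fls_const g * fls_X_inv + fls_const h"

abbreviation D :: "'a \<Rightarrow> 'a" where
  "D \<equiv> \<lambda>r. g * d r"

lemma derivation_D: "derivation_on UNIV D"
  by (simp add: derivation_on_def d_add d_mult algebra_simps)

lemma w_skew_mult: "w \<star> q = fls_const g * (fls_X_inv \<star> q) + fls_const h * q"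
  using skew_times_const_left[of d h q] by (simp add: w_def skew_mult_add_left const_times_skew_mult)

lemma w_skew_mult_nth: "(w \<star> q) $$ k = g * (q $$ (k + 1) - d (q $$ k)) + h * q $$ k"
  by (simp add: w_skew_mult X_inv_skew_mult_nth)

lemma w_skew_mult_const_times:
  "w \<star> (fls_const b * q) = fls_const b * (w \<star> q) - fls_const (D b) * q"
  by (rule fls_eqI) (simp add: w_skew_mult_nth d_mult algebra_simps)

lemma w_nonzero: "w \<noteq> 0"
proof
  assume "w = 0"
  then have "w $$ (- 1) = 0" by simp
  then have "g = 0" by (simp add: w_def)
  with g_inverse show False by simp
qed

lemma order_w: "w \<in> order_ge (- 1)"
  by (rule order_geI) (simp add: w_def)

text \<open>
  Comparing coefficients in \<open>w u = 1\<close> gives \<open>u\<^sub>1 = g^(-1)\<close> and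
  \<open>u\<^sub>k\<^sub>+\<^sub>1 = d(u\<^sub>k) - g^(-1) h u\<^sub>k\<close>, so \<open>u\<close> is found by iterating one map.
\<close>

lemma w_right_inverse: obtains u where "u \<in> order_ge 1" "w \<star> u = 1"
proof -
  define T where "T r = d r - g' * h * r" for r
  define u where "u = Abs_fls (\<lambda>k. if k < 1 then 0 else (T ^^ nat (k - 1)) g')"
  have u: "u $$ k = (if k < 1 then 0 else (T ^^ nat (k - 1)) g')" for k
    unfolding u_def by (rule nth_Abs_fls_lower_bound[of 1]) auto
  have "w \<star> u = 1"
  proof (rule fls_eqI)
    fix k
    have "(w \<star> u) $$ k = (if k = 0 then 1 else 0)"
    proof (cases "k < 1")
      case True
      then show ?thesis by (auto simp: w_skew_mult_nth u g_inverse)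
    next
      case False
      then have "nat k = Suc (nat (k - 1))" by simp
      with False have "u $$ (k + 1) = T (u $$ k)" by (simp add: u)
      from w_skew_mult_nth[of u k, unfolded this] have "(w \<star> u) $$ k = h * u $$ k - (g * g') * (h * u $$ k)"
        by (simp add: T_def algebra_simps)
      with False show ?thesis by (simp add: g_inverse)
    qed
    then show "(w \<star> u) $$ k = 1 $$ k" by simp
  qed
  moreover have "u \<in> order_ge 1" by (rule order_geI) (simp add: u)
  ultimately show thesis by (intro that)
qed

text \<open>
  In a ring without zero divisors a right inverse is also a left inverse.
\<close>

lemma w_unit: "w \<in> Units skew_ring" and order_inv_w: "inv\<^bsub>skew_ring\<^esub> w \<in> order_ge 1"
proof -
  obtain u where u: "u \<in> order_ge 1" "w \<star> u = 1" by (rule w_right_inverse)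
  have "w \<star> (u \<star> w) = w \<star> 1"
    using u(2) by (simp flip: skew_mult_assoc)
  then have "u \<star> w = 1" by (rule skew_mult_left_cancel[OF w_nonzero])
  with u(2) show "w \<in> Units skew_ring" by (auto simp: Units_def)
  have "u = inv\<^bsub>skew_ring\<^esub> w"
    by (rule B.inv_unique') (simp_all add: u \<open>u \<star> w = 1\<close>)
  with u(1) show "inv\<^bsub>skew_ring\<^esub> w \<in> order_ge 1" by simp
qed

definition inv_w_pow :: "int \<Rightarrow> 'a fls" where
  "inv_w_pow i = inv\<^bsub>skew_ring\<^esub> w [^]\<^bsub>skew_ring\<^esub> i"

lemma inv_w_pow_add: "inv_w_pow (i + j) = inv_w_pow i \<star> inv_w_pow j"
  and inv_w_pow_minus_one: "inv_w_pow (- 1) = w"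
proof -
  interpret U: group "units_of skew_ring" by (rule B.units_group)
  let ?u = "inv\<^bsub>skew_ring\<^esub> w"
  have u: "?u \<in> Units skew_ring" by (rule B.Units_inv_Units[OF w_unit])
  have nat_pow: "?u [^]\<^bsub>units_of skew_ring\<^esub> n = ?u [^]\<^bsub>skew_ring\<^esub> n" for n :: nat
    by (rule B.units_of_pow[OF u])
  have closed: "?u [^]\<^bsub>skew_ring\<^esub> n \<in> Units skew_ring" for n :: nat
    using U.nat_pow_closed[of ?u n] u unfolding units_of_carrier nat_pow by simp
  have pow: "inv_w_pow i = ?u [^]\<^bsub>units_of skew_ring\<^esub> i" for i :: int
    unfolding inv_w_pow_def int_pow_def2 nat_pow B.units_of_inv[OF closed] by (rule refl)
  show "inv_w_pow (i + j) = inv_w_pow i \<star> inv_w_pow j"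
    using U.int_pow_mult[of ?u i j] u unfolding pow units_of_carrier units_of_mult by simp
  show "inv_w_pow (- 1) = w"
    using w_unit by (simp add: inv_w_pow_def int_pow_def2)
qed

lemma inv_w_pow_zero [simp]: "inv_w_pow 0 = 1"
  by (simp add: inv_w_pow_def)

lemma inv_w_pow_one: "inv_w_pow 1 = inv\<^bsub>skew_ring\<^esub> w"
  by (simp add: inv_w_pow_def int_pow_def2)

lemma w_skew_mult_inv_w_pow: "w \<star> inv_w_pow i = inv_w_pow (i - 1)"
  using inv_w_pow_add[of "- 1" i] by (simp add: inv_w_pow_minus_one)

lemma order_inv_w_pow: "inv_w_pow i \<in> order_ge i"
proof (induction i rule: int_induct[of _ 0])
  case base
  then show ?case by (simp add: order_ge_def)
next
  case (step1 i)
  with order_ge_skew_mult[OF _ order_inv_w, of _ i] show ?case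
    by (simp add: inv_w_pow_add inv_w_pow_one)
next
  case (step2 i)
  with order_ge_skew_mult[OF order_w, of _ i] show ?case
    by (simp flip: w_skew_mult_inv_w_pow)
qed

text \<open>
  The evaluation of a series at \<open>w^(-1)\<close>, with the coefficients on the left.
\<close>

definition subst :: "'a fls \<Rightarrow> 'a fls" where
  "subst = coefficient_series inv_w_pow"

lemma order_continuous_subst: "order_continuous subst"
  unfolding subst_def by (rule order_continuous_coefficient_series)

lemmas subst_add = order_continuous_add[OF order_continuous_subst]
lemmas subst_diff = order_continuous_diff[OF order_continuous_subst]

lemma subst_monom: "subst (fls_monom a i) = fls_const a * inv_w_pow i"
  unfolding subst_def by (rule coefficient_series_monom) (rule order_inv_w_pow)

lemma subst_const_times: "subst (fls_const a * c) = fls_const a * subst c"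
  unfolding subst_def by (rule coefficient_series_const_times)

lemma subst_const: "subst (fls_const a) = fls_const a"
  using subst_monom[of a 0] by (simp add: fls_monom_zero_eq_const)

lemma subst_one: "subst 1 = 1"
  using subst_const[of 1] by simp

lemma order_ge_subst: "c \<in> order_ge s \<Longrightarrow> subst c \<in> order_ge s"
  unfolding subst_def by (rule order_ge_coefficient_series)

text \<open>
  In the source the variable is \<open>w^(-1)\<close> and the derivation is \<open>D\<close>; its rule for moving the inverse
  variable past a coefficient is the one that \<open>w\<close> satisfies in the target.
\<close>

lemma subst_X_inv_skew_mult: "subst (skew_times D fls_X_inv q) = w \<star> subst q"
proof -
  interpret D: skew_derivation D by unfold_locales (rule derivation_D)
  show ?thesis
  proof (rule order_continuous_eqI[of "\<lambda>q. subst (skew_times D fls_X_inv q)" "\<lambda>q. w \<star> subst q"])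
    show "order_continuous (\<lambda>q. subst (skew_times D fls_X_inv q))"
      by (rule order_continuous_compose[OF order_continuous_subst D.order_continuous_skew_mult_left])
    show "order_continuous (\<lambda>q. w \<star> subst q)"
      by (rule order_continuous_compose[OF order_continuous_skew_mult_left order_continuous_subst])
    fix b j
    show "subst (skew_times D fls_X_inv (fls_monom b j)) = w \<star> subst (fls_monom b j)"
      by (simp add: D.X_inv_skew_mult_monom subst_diff subst_monom w_skew_mult_const_times
          w_skew_mult_inv_w_pow)
  qed
qed

lemma subst_X_power_skew_mult: "subst (skew_times D (fls_monom 1 i) q) = inv_w_pow i \<star> subst q"
proof (induction i rule: int_predecessor_induct)
  case zero
  interpret D: skew_derivation D by unfold_locales (rule derivation_D)
  show ?case by (simp add: fls_monom_zero_eq_const)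
next
  case (step i)
  interpret D: skew_derivation D by unfold_locales (rule derivation_D)
  have "subst (skew_times D (fls_monom 1 (i - 1)) q) = w \<star> subst (skew_times D (fls_monom 1 i) q)"
    by (simp flip: D.X_inv_skew_mult_X_power add: subst_X_inv_skew_mult)
  moreover have "inv_w_pow (i - 1) \<star> subst q = w \<star> (inv_w_pow i \<star> subst q)"
    by (simp flip: w_skew_mult_inv_w_pow add: skew_mult_assoc)
  ultimately show ?case
    using skew_mult_left_cancel[OF w_nonzero] by metis
qed

lemma subst_skew_mult: "subst (skew_times D p q) = subst p \<star> subst q"
proof -
  interpret D: skew_derivation D by unfold_locales (rule derivation_D)
  show ?thesis
  proof (rule order_continuous_eqI[of "\<lambda>p. subst (skew_times D p q)" "\<lambda>p. subst p \<star> subst q"])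
    show "order_continuous (\<lambda>p. subst (skew_times D p q))"
      by (rule order_continuous_compose[OF order_continuous_subst D.order_continuous_skew_mult_right])
    show "order_continuous (\<lambda>p. subst p \<star> subst q)"
      by (rule order_continuous_compose[OF order_continuous_skew_mult_right order_continuous_subst])
    show "subst (skew_times D (fls_monom a i) q) = subst (fls_monom a i) \<star> subst q" for a i
      unfolding D.monom_skew_mult[of a i] subst_const_times subst_X_power_skew_mult subst_monom
        const_times_skew_mult ..
  qed
qed

lemma inverse_coordinate_change: "coordinate_change D g' g"
proof (unfold_locales)
  show "derivation_on UNIV D" by (rule derivation_D)
  show "g' * g = 1" using g_inverse by (simp add: mult.commute)
qed

text \<open>
  Evaluation at \<open>w^(-1)\<close> sends \<open>g^(-1) x^(-1) - g^(-1) h\<close> to \<open>g^(-1) w - g^(-1) h = x^(-1)\<close>, hence,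
  being multiplicative, sends the powers of that element to those of \<open>x^(-1)\<close>.
\<close>

lemma subst_inverse_subst: "subst (coordinate_change.subst D g' (- g' * h) p) = p"
proof -
  interpret D: coordinate_change D g' "- g' * h" g by (rule inverse_coordinate_change)
  have "subst D.w = fls_const g' * w - fls_const (g' * h)"
    unfolding D.w_def
    by (simp add: subst_add subst_diff subst_const_times subst_const fls_X_inv_eq_monom subst_monom
        inv_w_pow_minus_one)
  also have "\<dots> = fls_X_inv"
    using g_inverse by (intro fls_eqI) (auto simp: w_def distrib_left mult.commute[of g'])
  finally have w: "subst D.w = fls_X_inv" .
  have pow: "subst (D.inv_w_pow i) = fls_monom 1 i" for i
  proof (induction i rule: int_predecessor_induct)
    case zero
    then show ?case
      unfolding D.inv_w_pow_zero by (simp add: subst_one fls_monom_zero_eq_const)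
  next
    case (step i)
    have "subst (D.inv_w_pow (i - 1)) = fls_X_inv \<star> subst (D.inv_w_pow i)"
      unfolding D.w_skew_mult_inv_w_pow[symmetric] subst_skew_mult w ..
    moreover have "fls_monom 1 (i - 1) = fls_X_inv \<star> fls_monom 1 i"
      by (rule fls_eqI) (auto simp: X_inv_skew_mult_monom)
    ultimately show ?case
      using X_inv_skew_mult_inject by metis
  qed
  show ?thesis
  proof (rule order_continuous_eqI[of "\<lambda>p. subst (D.subst p)" "\<lambda>p. p"])
    show "order_continuous (\<lambda>p. subst (D.subst p))"
      by (rule order_continuous_compose[OF order_continuous_subst D.order_continuous_subst])
    show "subst (D.subst (fls_monom a i)) = fls_monom a i" for a i
      unfolding D.subst_monom subst_const_times pow by (rule fls_monom_eq_const_times[symmetric])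
  qed (rule order_continuous_id)
qed

text \<open>
  The same fact for the inverse change of variable, whose own inverse is the original one.
\<close>

lemma inverse_subst_subst: "coordinate_change.subst D g' (- g' * h) (subst c) = c"
proof -
  interpret D: coordinate_change D g' "- g' * h" g by (rule inverse_coordinate_change)
  have "g' * g = 1"
    using g_inverse by (simp add: mult.commute)
  then have "(\<lambda>r. g' * (g * d r)) = d"
    by (simp flip: mult.assoc)
  moreover have "- g * (- g' * h) = h"
    by (simp add: g_inverse flip: mult.assoc)
  moreover note D.subst_inverse_subst[of c]
  ultimately show ?thesis by (simp only:)
qed

lemma inj_subst: "inj subst"
  by (metis injI inverse_subst_subst)

lemma subst_order_ge: "\<exists>c\<in>order_ge s. subst c = p" if "p \<in> order_ge s"
proof -
  interpret D: coordinate_change D g' "- g' * h" g by (rule inverse_coordinate_change)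
  show ?thesis
    using D.order_ge_subst[OF that] subst_inverse_subst by blast
qed

lemma inverse_poly_inv_w_pow:
  assumes "i \<le> 0"
  shows "inv_w_pow i \<in> inverse_poly_part"
  using assms
proof (induction i rule: int_le_induct)
  case base
  then show ?case by (simp add: inverse_poly_part_def)
next
  case (step i)
  then show ?case
    by (simp add: inverse_poly_part_def w_skew_mult_nth flip: w_skew_mult_inv_w_pow)
qed

text \<open>
  A series in \<open>w^(-1)\<close> without positive powers is a polynomial in \<open>w\<close>, and \<open>w\<close> is a polynomial in
  \<open>x^(-1)\<close>.
\<close>

lemma inverse_poly_subst:
  assumes "c \<in> inverse_poly_part"
  shows "subst c \<in> inverse_poly_part"
proof -
  have "c $$ i * inv_w_pow i $$ k = 0" if "k > 0" for i k
    using assms inverse_poly_inv_w_pow[of i] that by (cases "i \<le> 0") (auto simp: inverse_poly_part_def)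
  then show ?thesis
    by (auto simp: inverse_poly_part_def subst_def coefficient_series_nth[OF order_ge_subdegree]
        intro!: sum.neutral)
qed

lemma subst_inverse_poly: "\<exists>c\<in>inverse_poly_part. subst c = p" if "p \<in> inverse_poly_part"
proof -
  interpret D: coordinate_change D g' "- g' * h" g by (rule inverse_coordinate_change)
  show ?thesis
    using D.inverse_poly_subst[OF that] subst_inverse_subst by blast
qed

text \<open>
  For \<open>p\<close> of positive order, \<open>F (1 + p)\<close> has order zero, hence \<open>F p\<close> has order at least zero. Any
  \<open>p\<close> of order \<open>s\<close> becomes one of order one after multiplication by \<open>w^(s-1)\<close>, a factor that \<open>F\<close>
  fixes.
\<close>

lemma order_continuous_hom_fixing_w:
  fixes F :: "'a fls \<Rightarrow> 'a fls" and half :: 'a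
  assumes half: "2 * half = 1"
    and F_add: "\<And>p q. F (p + q) = F p + F q" and F_mult: "\<And>p q. F (p \<star> q) = F p \<star> F q"
    and F_one: "F 1 = 1" and F_nonzero: "\<And>p. p \<noteq> 0 \<Longrightarrow> F p \<noteq> 0" and F_w: "F w = w"
  shows "F (inv_w_pow i) = inv_w_pow i" and "order_continuous F"
proof -
  show pow: "F (inv_w_pow i) = inv_w_pow i" for i
  proof (induction i rule: int_predecessor_induct)
    case zero
    then show ?case by (simp add: F_one)
  next
    case (step i)
    have "F (inv_w_pow (i - 1)) = w \<star> F (inv_w_pow i)"
      by (simp add: F_mult F_w flip: w_skew_mult_inv_w_pow)
    moreover have "inv_w_pow (i - 1) = w \<star> inv_w_pow i"
      by (simp add: w_skew_mult_inv_w_pow)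
    ultimately show ?case
      using skew_mult_left_cancel[OF w_nonzero] by metis
  qed
  have 1: "F p \<in> order_ge 0" if p: "p \<in> order_ge 1" for p
  proof -
    have "fls_subdegree (F (1 + p)) = 0"
      by (rule injective_hom_principal_unit_order[OF half F_mult F_nonzero]) (simp_all add: p)
    then have "1 + F p \<in> order_ge 0"
      using order_ge_subdegree[of "F (1 + p)"] by (simp add: F_add F_one)
    moreover have "(1 :: 'a fls) \<in> order_ge 0" by (simp add: order_ge_def)
    ultimately have "(1 + F p) - 1 \<in> order_ge 0" by (rule order_ge_diff)
    then show ?thesis by simp
  qed
  have "F p \<in> order_ge (s + - 1)" if p: "p \<in> order_ge s" for s p
  proof -
    have "inv_w_pow (1 - s) \<star> p \<in> order_ge 1"
      using order_ge_skew_mult[OF order_inv_w_pow p, of "1 - s"] by simp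
    then have "inv_w_pow (s - 1) \<star> F (inv_w_pow (1 - s) \<star> p) \<in> order_ge (s - 1)"
      using order_ge_skew_mult[OF order_inv_w_pow 1, of _ "s - 1"] by simp
    moreover have "inv_w_pow (s - 1) \<star> F (inv_w_pow (1 - s) \<star> p) = F p"
      by (simp add: F_mult pow flip: skew_mult_assoc inv_w_pow_add)
    ultimately show ?thesis by simp
  qed
  then show "order_continuous F"
    by (intro order_continuousI[of _ "- 1"]) (auto simp: F_add)
qed

text \<open>
  By continuity \<open>F\<close> acts on a series in \<open>w^(-1)\<close> through its coefficients, and a series in \<open>w^(-1)\<close>
  determines its coefficients.
\<close>

lemma fixed_subst_iff:
  fixes F :: "'a fls \<Rightarrow> 'a fls" and half :: 'a
  assumes half: "2 * half = 1"
    and F_add: "\<And>p q. F (p + q) = F p + F q" and F_mult: "\<And>p q. F (p \<star> q) = F p \<star> F q"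
    and F_one: "F 1 = 1" and F_nonzero: "\<And>p. p \<noteq> 0 \<Longrightarrow> F p \<noteq> 0" and F_w: "F w = w"
    and F_const: "\<And>a. F (fls_const a) \<in> range fls_const"
  shows "F (subst c) = subst c \<longleftrightarrow> (\<forall>i. F (fls_const (c $$ i)) = fls_const (c $$ i))"
proof -
  note F = order_continuous_hom_fixing_w[OF half F_add F_mult F_one F_nonzero F_w]
  \<comment> \<open>\<open>\<sigma>\<close> is the map induced by \<open>F\<close> on \<open>R\<close>, and \<open>M\<close> applies it to every coefficient.\<close>
  define \<sigma> where "\<sigma> a = F (fls_const a) $$ 0" for a
  have \<sigma>: "F (fls_const a) = fls_const (\<sigma> a)" for a
    using F_const[of a] by (auto simp: \<sigma>_def)
  have \<sigma>_add: "\<sigma> (a + b) = \<sigma> a + \<sigma> b" for a b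
    by (simp add: \<sigma>_def F_add flip: fls_plus_const)
  have \<sigma>_zero: "\<sigma> 0 = 0" by (rule additive_zero) (rule \<sigma>_add)
  define M where "M p = Abs_fls (\<lambda>k. \<sigma> (p $$ k))" for p
  have M_nth: "M p $$ k = \<sigma> (p $$ k)" for p k
    unfolding M_def by (rule nth_Abs_fls_lower_bound[of "fls_subdegree p"]) (simp add: \<sigma>_zero)
  have "F (subst c) = subst (M c)"
  proof (rule order_continuous_eqI[of "\<lambda>c. F (subst c)" "\<lambda>c. subst (M c)"])
    show "order_continuous (\<lambda>c. F (subst c))"
      by (rule order_continuous_compose[OF F(2) order_continuous_subst]) 
    have "order_continuous M"
      by (rule order_continuousI[of _ 0])
        (auto intro!: fls_eqI order_geI simp: M_nth \<sigma>_add \<sigma>_zero order_geD)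
    then show "order_continuous (\<lambda>c. subst (M c))"
      by (rule order_continuous_compose[OF order_continuous_subst])
    fix a i
    have "M (fls_monom a i) = fls_monom (\<sigma> a) i"
      by (rule fls_eqI) (simp add: M_nth \<sigma>_zero)
    moreover have "F (fls_const a * inv_w_pow i) = fls_const (\<sigma> a) * inv_w_pow i"
      using F_mult[of "fls_const a" "inv_w_pow i"] by (simp add: skew_times_const_left F(1) \<sigma>)
    ultimately show "F (subst (fls_monom a i)) = subst (M (fls_monom a i))"
      by (simp add: subst_monom)
  qed
  then have "F (subst c) = subst c \<longleftrightarrow> M c = c"
    by (simp add: inj_eq[OF inj_subst])
  also have "\<dots> \<longleftrightarrow> (\<forall>i. F (fls_const (c $$ i)) = fls_const (c $$ i))"
    by (auto simp: fls_eq_iff M_nth \<sigma>)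
  finally show ?thesis .
qed

lemma inv_w_pow_minus_nat: "inv_w_pow (- int n) = w [^]\<^bsub>skew_ring\<^esub> n"
proof (induction n)
  case (Suc n)
  have "w [^]\<^bsub>skew_ring\<^esub> Suc n = w \<star> (w [^]\<^bsub>skew_ring\<^esub> n)"
    using B.nat_pow_Suc2[of w n] by simp
  also have "\<dots> = inv_w_pow (- int (Suc n))"
    unfolding Suc.IH[symmetric] w_skew_mult_inv_w_pow by (rule arg_cong[of _ _ inv_w_pow]) simp
  finally show ?case ..
qed simp

lemma eval_poly_at_w: "eval_poly_at skew_ring w p = subst (inverse_poly p)"
  by (simp add: eval_poly_at_def inverse_poly_conv_sum order_continuous_sum[OF order_continuous_subst]
      subst_monom skew_times_const_left inv_w_pow_minus_nat)

lemma laurent_term_has_sum: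
  "(laurent_term skew_ring (inv\<^bsub>skew_ring\<^esub> w) c has_sum subst c) UNIV"
proof -
  have "laurent_term skew_ring (inv\<^bsub>skew_ring\<^esub> w) c = (\<lambda>i. fls_const (c $$ i) * inv_w_pow i)"
    by (simp add: laurent_term_def skew_times_const_left inv_w_pow_def fun_eq_iff)
  then show ?thesis
    using has_sum_coefficient_series[OF order_inv_w_pow, of c] by (simp add: subst_def)
qed

lemma eval_series_at_inv_w: "eval_series_at skew_ring (inv\<^bsub>skew_ring\<^esub> w) = subst"
  unfolding eval_series_at_def using infsumI[OF laurent_term_has_sum] by blast

lemma surj_subst: "\<exists>c. subst c = p"
  using subst_inverse_subst by blast

lemma subst_ring_iso_Laurent:
  assumes T: "\<And>c. subst c \<in> T \<longleftrightarrow> (\<forall>i. c $$ i \<in> S)"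
  shows "subst \<in> ring_iso (skew_laurent_ring S D) (skew_ring\<lparr>carrier := T\<rparr>)"
proof -
  have "bij_betw subst {c. \<forall>i. c $$ i \<in> S} T"
  proof (rule bij_betw_imageI)
    show "subst ` {c. \<forall>i. c $$ i \<in> S} = T"
    proof (intro equalityI subsetI)
      fix p assume p: "p \<in> T"
      obtain c where "subst c = p" using surj_subst by blast
      with p T show "p \<in> subst ` {c. \<forall>i. c $$ i \<in> S}" by blast
    qed (auto simp: T)
  qed (rule inj_on_subset[OF inj_subst], simp)
  then show ?thesis
    by (auto simp: ring_iso_def ring_hom_def skew_laurent_ring_def T subst_skew_mult subst_add subst_one)
qed

lemma subst_ring_iso_power_series:
  assumes T: "\<And>c. subst c \<in> T \<longleftrightarrow> (\<forall>i. c $$ i \<in> S)"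
  shows "subst \<in> ring_iso (skew_power_series_ring S D) (skew_ring\<lparr>carrier := power_series_part \<inter> T\<rparr>)"
proof -
  have ps: "power_series_part = order_ge 0"
    by (simp add: power_series_part_def order_ge_def)
  have "bij_betw subst ({c. \<forall>i. c $$ i \<in> S} \<inter> order_ge 0) (order_ge 0 \<inter> T)"
  proof (rule bij_betw_imageI)
    show "subst ` ({c. \<forall>i. c $$ i \<in> S} \<inter> order_ge 0) = order_ge 0 \<inter> T"
    proof (intro equalityI subsetI)
      fix p assume p: "p \<in> order_ge 0 \<inter> T"
      then obtain c where "c \<in> order_ge 0" "subst c = p" using subst_order_ge by blast
      with p T show "p \<in> subst ` ({c. \<forall>i. c $$ i \<in> S} \<inter> order_ge 0)" by blast
    qed (auto simp: T order_ge_subst)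
  qed (rule inj_on_subset[OF inj_subst], simp)
  then show ?thesis
    by (auto simp: ring_iso_def ring_hom_def skew_power_series_ring_def skew_laurent_ring_def ps T
        order_ge_subst subst_skew_mult subst_add subst_one)
qed

lemma eval_poly_ring_iso:
  assumes T: "\<And>c. subst c \<in> T \<longleftrightarrow> (\<forall>i. c $$ i \<in> S)" and S: "0 \<in> S"
  shows "eval_poly_at skew_ring w
    \<in> ring_iso (skew_poly_ring S (\<lambda>r. - D r)) (skew_ring\<lparr>carrier := inverse_poly_part \<inter> T\<rparr>)"
proof -
  interpret D: skew_derivation D by unfold_locales (rule derivation_D)
  have eval: "eval_poly_at skew_ring w = (\<lambda>p. subst (inverse_poly p))"
    by (simp add: eval_poly_at_w fun_eq_iff)
  have coeffs: "(\<forall>i. inverse_poly p $$ i \<in> S) \<longleftrightarrow> (\<forall>i. coeff p i \<in> S)" for p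
  proof
    assume *: "\<forall>i. inverse_poly p $$ i \<in> S"
    show "\<forall>n. coeff p n \<in> S"
    proof
      show "coeff p n \<in> S" for n
        using *[rule_format, of "- int n"] by (simp add: inverse_poly_nth)
    qed
  qed (simp add: inverse_poly_nth S)
  have part: "subst (inverse_poly p) \<in> inverse_poly_part" for p
    using range_inverse_poly by (intro inverse_poly_subst) blast
  have "bij_betw (\<lambda>p. subst (inverse_poly p)) {p. \<forall>i. coeff p i \<in> S} (inverse_poly_part \<inter> T)"
  proof (rule bij_betw_imageI)
    show "inj_on (\<lambda>p. subst (inverse_poly p)) {p. \<forall>i. coeff p i \<in> S}"
      by (rule inj_onI) (metis injD inj_subst inj_inverse_poly)
    show "(\<lambda>p. subst (inverse_poly p)) ` {p. \<forall>i. coeff p i \<in> S} = inverse_poly_part \<inter> T"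
    proof (intro equalityI subsetI)
      fix f assume f: "f \<in> inverse_poly_part \<inter> T"
      then obtain c where "c \<in> inverse_poly_part" "subst c = f" using subst_inverse_poly by blast
      then obtain p where "subst (inverse_poly p) = f"
        unfolding range_inverse_poly[symmetric] by blast
      with f T coeffs show "f \<in> (\<lambda>p. subst (inverse_poly p)) ` {p. \<forall>i. coeff p i \<in> S}" by blast
    qed (auto simp: T coeffs part)
  qed
  then show ?thesis
    by (auto simp: ring_iso_def ring_hom_def skew_poly_ring_def eval T coeffs part
        D.inverse_poly_skew_poly_times inverse_poly_add inverse_poly_one subst_skew_mult subst_add
        subst_one)
qed

end

section \<open>Invariants\<close>

theorem theorem1p3p1:
  fixes d :: "'a::{idom, ring_char_0} \<Rightarrow> 'a"
    and \<iota> :: "rat \<Rightarrow> 'a"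
    and \<Gamma> :: "('g, 'm) monoid_scheme"
    and \<phi> :: "'g \<Rightarrow> 'a fls \<Rightarrow> 'a fls"
    and g h :: 'a
    and w :: "'a fls"
  defines "B \<equiv> skew_laurent_ring UNIV d"
  defines "B\<^sub>\<Gamma> \<equiv> invariant_elements \<Gamma> B \<phi>"
    and "R\<^sub>\<Gamma> \<equiv> coefficient_invariants \<Gamma> \<phi>"
    and "D \<equiv> (\<lambda>r. g * d r)"
  assumes "rat_embedding \<iota>"
    and "derivation_on UNIV d" and "d \<noteq> (\<lambda>_. 0)"
    and "group \<Gamma>" and "acts_by_ring_automorphisms \<Gamma> B \<phi>"
    and "stabilizes_coefficients \<Gamma> \<phi>"
    and "g dvd 1"
    and "w = fls_const g \<otimes>\<^bsub>B\<^esub> fls_X_inv \<oplus>\<^bsub>B\<^esub> fls_const h"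
    and "w \<in> B\<^sub>\<Gamma>"
  shows "derivation_on R\<^sub>\<Gamma> D \<and>
    eval_poly_at B w
      \<in> ring_iso (skew_poly_ring R\<^sub>\<Gamma> (\<lambda>r. - D r)) (B\<lparr>carrier := inverse_poly_part \<inter> B\<^sub>\<Gamma>\<rparr>) \<and>
    w \<in> Units B \<and>
    (\<forall>c \<in> carrier (skew_laurent_ring R\<^sub>\<Gamma> D).
      laurent_term B (inv\<^bsub>B\<^esub> w) c summable_on UNIV) \<and>
    eval_series_at B (inv\<^bsub>B\<^esub> w)
      \<in> ring_iso (skew_power_series_ring R\<^sub>\<Gamma> D) (B\<lparr>carrier := power_series_part \<inter> B\<^sub>\<Gamma>\<rparr>) \<and>
    eval_series_at B (inv\<^bsub>B\<^esub> w)
      \<in> ring_iso (skew_laurent_ring R\<^sub>\<Gamma> D) (B\<lparr>carrier := B\<^sub>\<Gamma>\<rparr>)"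
proof -
  obtain g' where g': "g * g' = 1" using \<open>g dvd 1\<close> by (auto elim: dvdE)
  interpret C: coordinate_change d g h g'
    by unfold_locales (use \<open>derivation_on UNIV d\<close> g' in auto)
  have half: "2 * \<iota> (1 / 2) = 1"
  proof -
    have "\<iota> (1 / 2 + 1 / 2) = \<iota> (1 / 2) + \<iota> (1 / 2)" "\<iota> 1 = 1"
      using \<open>rat_embedding \<iota>\<close> unfolding rat_embedding_def by blast+
    then show ?thesis
      unfolding mult_2 by (metis field_sum_of_halves)
  qed
  have w: "w = C.w"
    unfolding assms(12) B_def C.skew_ring_simps C.w_def by (simp add: skew_times_const_left)
  have iso: "\<phi> \<gamma> \<in> ring_iso B B" if "\<gamma> \<in> carrier \<Gamma>" for \<gamma>
    using assms(9) that unfolding acts_by_ring_automorphisms_def by blast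
  have add: "\<phi> \<gamma> (p + q) = \<phi> \<gamma> p + \<phi> \<gamma> q"
    and mult: "\<phi> \<gamma> (skew_times d p q) = skew_times d (\<phi> \<gamma> p) (\<phi> \<gamma> q)"
    and one: "\<phi> \<gamma> 1 = 1" and inj: "inj (\<phi> \<gamma>)"
    if "\<gamma> \<in> carrier \<Gamma>" for \<gamma> p q
    using ring_iso_memE(2,3)[OF iso[OF that], of p q] ring_iso_memE(4,5)[OF iso[OF that]]
    unfolding B_def C.skew_ring_simps by (simp_all add: bij_betw_def)
  have zero: "\<phi> \<gamma> 0 = 0" if "\<gamma> \<in> carrier \<Gamma>" for \<gamma>
    by (rule additive_zero) (rule add[OF that])
  have nonzero: "\<phi> \<gamma> p \<noteq> 0" if "\<gamma> \<in> carrier \<Gamma>" "p \<noteq> 0" for \<gamma> p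
    using injD[OF inj[OF that(1)], of p 0] zero[OF that(1)] that(2) by auto
  have B\<^sub>\<Gamma>: "B\<^sub>\<Gamma> = {b. \<forall>\<gamma>\<in>carrier \<Gamma>. \<phi> \<gamma> b = b}"
    unfolding B\<^sub>\<Gamma>_def invariant_elements_def B_def by simp
  have fix_w: "\<phi> \<gamma> C.w = C.w" if "\<gamma> \<in> carrier \<Gamma>" for \<gamma>
    using assms(13) that unfolding B\<^sub>\<Gamma> w by blast
  have const: "\<phi> \<gamma> (fls_const a) \<in> range fls_const" if "\<gamma> \<in> carrier \<Gamma>" for \<gamma> a
    using \<open>stabilizes_coefficients \<Gamma> \<phi>\<close> that unfolding stabilizes_coefficients_def by blast
  have invariant_iff: "C.subst c \<in> B\<^sub>\<Gamma> \<longleftrightarrow> (\<forall>i. c $$ i \<in> R\<^sub>\<Gamma>)" for c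
  proof -
    have "\<phi> \<gamma> (C.subst c) = C.subst c \<longleftrightarrow> (\<forall>i. \<phi> \<gamma> (fls_const (c $$ i)) = fls_const (c $$ i))"
      if \<gamma>: "\<gamma> \<in> carrier \<Gamma>" for \<gamma>
      by (rule C.fixed_subst_iff[OF half add[OF \<gamma>] mult[OF \<gamma>] one[OF \<gamma>] nonzero[OF \<gamma>] fix_w[OF \<gamma>]
            const[OF \<gamma>]])
    then show ?thesis
      unfolding B\<^sub>\<Gamma> R\<^sub>\<Gamma>_def coefficient_invariants_def by blast
  qed
  have zero_invariant: "0 \<in> R\<^sub>\<Gamma>"
    using zero by (simp add: R\<^sub>\<Gamma>_def coefficient_invariants_def)
  have "D a \<in> R\<^sub>\<Gamma>" if "a \<in> R\<^sub>\<Gamma>" for a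
  proof -
    have a: "\<phi> \<gamma> (fls_const a) = fls_const a" if "\<gamma> \<in> carrier \<Gamma>" for \<gamma>
      using \<open>a \<in> R\<^sub>\<Gamma>\<close> that by (simp add: R\<^sub>\<Gamma>_def coefficient_invariants_def)
    \<comment> \<open>The derivation is the commutator with \<open>w\<close>, which is invariant.\<close>
    have commutator: "fls_const (D a)
        = skew_times d (fls_const a) C.w - skew_times d C.w (fls_const a)"
      using C.w_skew_mult_const_times[of a 1] by (simp add: skew_times_const_left D_def)
    have "\<phi> \<gamma> (fls_const (D a)) = fls_const (D a)" if "\<gamma> \<in> carrier \<Gamma>" for \<gamma>
      unfolding commutator additive_diff[of "\<phi> \<gamma>", OF add[OF that]] mult[OF that] a[OF that]
        fix_w[OF that] ..
    then show ?thesis by (simp add: R\<^sub>\<Gamma>_def coefficient_invariants_def)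
  qed
  then have "derivation_on R\<^sub>\<Gamma> D"
    using C.derivation_D unfolding derivation_on_def D_def by blast
  moreover have "laurent_term B (inv\<^bsub>B\<^esub> w) c summable_on UNIV" for c
    using C.laurent_term_has_sum[of c] unfolding w B_def by (rule has_sum_imp_summable)
  moreover note C.eval_poly_ring_iso[OF invariant_iff zero_invariant] C.w_unit
    C.subst_ring_iso_power_series[OF invariant_iff] C.subst_ring_iso_Laurent[OF invariant_iff]
  ultimately show ?thesis
    unfolding w B_def D_def C.eval_series_at_inv_w by (intro conjI ballI)
qed

end
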